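(* Let $n$ be an odd positive integer, let $\mathbb{Z}_n\rtimes\mathbb{Z}_2$ be a semidirect product (with respect to some action of $\mathbb{Z}_2$ on $\mathbb{Z}_n$ by automorphisms), and let $N$ be a group of order $2n$ such that the pair $(\mathbb{Z}_n\rtimes\mathbb{Z}_2,\,N)$ is realizable. Then there exist positive integers $k,l$ with $\gcd(k,l)=1$ and $kl=n$ such that $N\cong(\mathbb{Z}_k\rtimes\mathbb{Z}_l)\rtimes\mathbb{Z}_2$ for some semidirect products of the indicated form.
   Context: $\mathbb{Z}_m$ denotes the cyclic group of order $m$. For a group $N$, the holomorph is $\mathrm{Hol}(N)=N\rtimes\mathrm{Aut}(N)$, regarded as a group of permutations of $N$ via $(x,\alpha)\cdot y=x\,\alpha(y)$. A subgroup of $\mathrm{Hol}(N)$ is regular if it acts on $N$ transitively with trivial point stabilizers. For finite groups $G,N$ with $|G|=|N|$, the (ordered) pair $(G,N)$ is called realizable (Hopf-Galois realizable) if $\mathrm{Hol}(N)$ has a regular subgroup isomorphic to $G$. In $A\rtimes B$ the factor $A$ is the normal one. *)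

theory Defs
  imports "HOL-Algebra.Algebra"
begin

text \<open>
  The external semidirect product with normal factor \<open>A\<close>.  The action is a homomorphism
  \<open>\<phi> \<in> hom B (AutoGroup A)\<close>; the definition itself does not require this.
\<close>

definition semidirect_product ::
  "('a, 'c) monoid_scheme \<Rightarrow> ('b \<Rightarrow> 'a \<Rightarrow> 'a) \<Rightarrow> ('b, 'd) monoid_scheme \<Rightarrow> ('a \<times> 'b) monoid"
where
  "semidirect_product A \<phi> B =
    \<lparr>carrier = carrier A \<times> carrier B,
     monoid.mult = (\<lambda>(a, b) (a', b'). (a \<otimes>\<^bsub>A\<^esub> \<phi> b a', b \<otimes>\<^bsub>B\<^esub> b')),
     one = (\<one>\<^bsub>A\<^esub>, \<one>\<^bsub>B\<^esub>)\<rparr>"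

definition holomorph :: "('a, 'c) monoid_scheme \<Rightarrow> ('a \<times> ('a \<Rightarrow> 'a)) monoid" where
  "holomorph N = semidirect_product N (\<lambda>\<alpha>. \<alpha>) (AutoGroup N)"

definition holomorph_action :: "('a, 'c) monoid_scheme \<Rightarrow> 'a \<times> ('a \<Rightarrow> 'a) \<Rightarrow> 'a \<Rightarrow> 'a" where
  "holomorph_action N = (\<lambda>(x, \<alpha>). \<lambda>y\<in>carrier N. x \<otimes>\<^bsub>N\<^esub> \<alpha> y)"

definition regular_subgroup ::
  "('a \<times> ('a \<Rightarrow> 'a)) set \<Rightarrow> ('a, 'c) monoid_scheme \<Rightarrow> bool"
where
  "regular_subgroup H N \<longleftrightarrow>
     subgroup H (holomorph N) \<and>
     transitive_action (holomorph N\<lparr>carrier := H\<rparr>) (carrier N) (holomorph_action N) \<and>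
     (\<forall>y\<in>carrier N. stabilizer (holomorph N\<lparr>carrier := H\<rparr>) (holomorph_action N) y
        = {\<one>\<^bsub>holomorph N\<^esub>})"

definition realizable :: "('g, 'c) monoid_scheme \<Rightarrow> ('a, 'd) monoid_scheme \<Rightarrow> bool" where
  "realizable G N \<longleftrightarrow>
     group G \<and> group N \<and> finite (carrier G) \<and> finite (carrier N) \<and> order G = order N \<and>
     (\<exists>H. regular_subgroup H N \<and> (holomorph N\<lparr>carrier := H\<rparr>) \<cong> G)"

lemma carrier_semidirect_product [simp]:
  "carrier (semidirect_product A \<phi> B) = carrier A \<times> carrier B"
  by (simp add: semidirect_product_def)

lemma mult_semidirect_product [simp]:
  "(a, b) \<otimes>\<^bsub>semidirect_product A \<phi> B\<^esub> (a', b') = (a \<otimes>\<^bsub>A\<^esub> \<phi> b a', b \<otimes>\<^bsub>B\<^esub> b')"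
  by (simp add: semidirect_product_def)

lemma one_semidirect_product [simp]:
  "\<one>\<^bsub>semidirect_product A \<phi> B\<^esub> = (\<one>\<^bsub>A\<^esub>, \<one>\<^bsub>B\<^esub>)"
  by (simp add: semidirect_product_def)

lemma group_semidirect_product:
  assumes "group A" "group B" and hom: "\<phi> \<in> hom B (AutoGroup A)"
  shows "group (semidirect_product A \<phi> B)"
proof -
  interpret A: group A by fact
  interpret B: group B by fact
  interpret h: group_hom B "AutoGroup A" \<phi>
    using hom by (simp add: group_hom_def group_hom_axioms_def A.AutoGroup B.is_group)
  have auto: "\<phi> b \<in> auto A" if "b \<in> carrier B" for b
    using h.hom_closed[OF that] by (simp add: AutoGroup_def)
  have closed [simp]: "\<phi> b a \<in> carrier A" if "b \<in> carrier B" "a \<in> carrier A" for a b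
    using auto[OF that(1)] that(2) by (auto simp: auto_def hom_def)
  have distr: "\<phi> b (a \<otimes>\<^bsub>A\<^esub> a') = \<phi> b a \<otimes>\<^bsub>A\<^esub> \<phi> b a'"
    if "b \<in> carrier B" "a \<in> carrier A" "a' \<in> carrier A" for a a' b
    using auto[OF that(1)] that(2,3) by (auto simp: auto_def hom_def)
  have comp: "\<phi> (b \<otimes>\<^bsub>B\<^esub> b') a = \<phi> b (\<phi> b' a)"
    if "b \<in> carrier B" "b' \<in> carrier B" "a \<in> carrier A" for a b b'
    using h.hom_mult[OF that(1,2)] auto[OF that(1)] auto[OF that(2)] that(3)
    by (simp add: AutoGroup_def BijGroup_def auto_def compose_def)
  have id [simp]: "\<phi> \<one>\<^bsub>B\<^esub> a = a" if "a \<in> carrier A" for a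
    using h.hom_one that by (simp add: AutoGroup_def BijGroup_def)
  show ?thesis
  proof (rule groupI, goal_cases)
    case (3 x y z)
    then show ?case by (auto simp: distr comp A.m_assoc B.m_assoc simp del: h.hom_mult)
  next
    case (5 x)
    then obtain a b where x: "x = (a, b)" "a \<in> carrier A" "b \<in> carrier B" by auto
    let ?b = "inv\<^bsub>B\<^esub> b" and ?a = "inv\<^bsub>A\<^esub> a"
    have b: "?b \<in> carrier B" using x by simp
    note [simp del] = h.hom_inv
    have "\<phi> ?b ?a \<otimes>\<^bsub>A\<^esub> \<phi> ?b a = \<phi> ?b \<one>\<^bsub>A\<^esub>"
      using distr[OF b, of ?a a] x by simp
    also have "\<dots> = \<one>\<^bsub>A\<^esub>"
      using distr[OF b, of "\<one>\<^bsub>A\<^esub>" "\<one>\<^bsub>A\<^esub>"] b by simp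
    finally show ?case
      using x b by (intro bexI[of _ "(\<phi> ?b ?a, ?b)"]) auto
  qed (auto simp del: h.hom_one)
qed

lemma group_holomorph:
  assumes "group N"
  shows "group (holomorph N)"
proof -
  interpret group N by fact
  show ?thesis
    unfolding holomorph_def
    by (rule group_semidirect_product) (auto simp: assms AutoGroup hom_def)
qed

lemma holomorph_action_faithful:
  assumes "group N"
  shows "faithful_action (holomorph N) (carrier N) (holomorph_action N)"
proof -
  interpret N: group N by fact
  have aut: "\<alpha> \<in> hom N N \<and> \<alpha> \<in> extensional (carrier N) \<and> bij_betw \<alpha> (carrier N) (carrier N)"
    if "\<alpha> \<in> auto N" for \<alpha>
    using that by (auto simp: auto_def Bij_def)
  have carr: "carrier (holomorph N) = carrier N \<times> auto N"
    by (simp add: holomorph_def AutoGroup_def)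
  have bij: "holomorph_action N g \<in> Bij (carrier N)" if g: "g \<in> carrier (holomorph N)" for g
  proof -
    obtain x \<alpha> where x: "g = (x, \<alpha>)" "x \<in> carrier N" "\<alpha> \<in> auto N"
      using g carr by auto
    have "bij_betw (\<lambda>y. x \<otimes>\<^bsub>N\<^esub> y) (carrier N) (carrier N)"
      using x by (intro bij_betwI[where g = "\<lambda>y. inv\<^bsub>N\<^esub> x \<otimes>\<^bsub>N\<^esub> y"])
        (auto simp flip: N.m_assoc)
    from bij_betw_trans[OF _ this] aut[OF x(3)]
    have "bij_betw (\<lambda>y. x \<otimes>\<^bsub>N\<^esub> \<alpha> y) (carrier N) (carrier N)"
      by (auto simp: o_def)
    then show ?thesis
      using x by (simp add: holomorph_action_def Bij_def cong: bij_betw_cong)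
  qed
  have mult: "holomorph_action N (g \<otimes>\<^bsub>holomorph N\<^esub> h)
      = holomorph_action N g \<otimes>\<^bsub>BijGroup (carrier N)\<^esub> holomorph_action N h"
    if g: "g \<in> carrier (holomorph N)" and h: "h \<in> carrier (holomorph N)" for g h
  proof -
    obtain x \<alpha> y \<beta> where gh: "g = (x, \<alpha>)" "x \<in> carrier N" "\<alpha> \<in> auto N"
      "h = (y, \<beta>)" "y \<in> carrier N" "\<beta> \<in> auto N"
      using g h carr by auto
    have "\<beta> z \<in> carrier N" "\<alpha> z \<in> carrier N" if "z \<in> carrier N" for z
      using that aut[OF gh(3)] aut[OF gh(6)] by (auto simp: hom_def)
    moreover have "\<alpha> (z \<otimes>\<^bsub>N\<^esub> w) = \<alpha> z \<otimes>\<^bsub>N\<^esub> \<alpha> w" if "z \<in> carrier N" "w \<in> carrier N" for z w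
      using that aut[OF gh(3)] by (auto simp: hom_def)
    moreover have "\<alpha> \<in> Bij (carrier N)" "\<beta> \<in> Bij (carrier N)"
      using gh by (auto simp: auto_def)
    ultimately have "holomorph_action N (g \<otimes>\<^bsub>holomorph N\<^esub> h)
        = compose (carrier N) (holomorph_action N g) (holomorph_action N h)"
      using gh
      by (auto simp: holomorph_action_def holomorph_def AutoGroup_def BijGroup_def compose_def
          N.m_assoc fun_eq_iff restrict_def)
    then show ?thesis
      using bij[OF g] bij[OF h] by (simp add: BijGroup_def)
  qed
  have "inj_on (holomorph_action N) (carrier (holomorph N))"
  proof (rule inj_onI)
    fix g h
    assume g: "g \<in> carrier (holomorph N)" and h: "h \<in> carrier (holomorph N)"
      and eq: "holomorph_action N g = holomorph_action N h"
    obtain x \<alpha> y \<beta> where gh: "g = (x, \<alpha>)" "x \<in> carrier N" "\<alpha> \<in> auto N"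
      "h = (y, \<beta>)" "y \<in> carrier N" "\<beta> \<in> auto N"
      using g h carr by auto
    have ev: "x \<otimes>\<^bsub>N\<^esub> \<alpha> z = y \<otimes>\<^bsub>N\<^esub> \<beta> z" if "z \<in> carrier N" for z
      using fun_cong[OF eq, of z] that gh by (simp add: holomorph_action_def)
    have "\<alpha> \<one>\<^bsub>N\<^esub> = \<one>\<^bsub>N\<^esub>" "\<beta> \<one>\<^bsub>N\<^esub> = \<one>\<^bsub>N\<^esub>"
      using aut[OF gh(3)] aut[OF gh(6)] by (auto intro: hom_one N.is_group)
    with ev[of "\<one>\<^bsub>N\<^esub>"] gh have xy: "x = y" by simp
    have "\<alpha> = \<beta>"
    proof (rule extensionalityI)
      fix z assume z: "z \<in> carrier N"
      have "\<alpha> z \<in> carrier N" "\<beta> z \<in> carrier N"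
        using z aut[OF gh(3)] aut[OF gh(6)] by (auto simp: hom_def)
      then show "\<alpha> z = \<beta> z"
        using ev[OF z] xy gh by simp
    qed (use aut gh in auto)
    with xy gh show "g = h" by simp
  qed
  moreover have "group_hom (holomorph N) (BijGroup (carrier N)) (holomorph_action N)"
    using bij mult group_holomorph[OF assms] group_BijGroup
    by (auto simp: group_hom_def group_hom_axioms_def hom_def) (auto simp: BijGroup_def)
  ultimately show ?thesis
    by (simp add: faithful_action_def faithful_action_axioms_def group_action_def)
qed

end

theory Submission
  imports Defs "HOL-Number_Theory.Residues"
begin

text \<open>
  Let \<open>K\<close> be the set of \<open>y \<in> N\<close> with \<open>y\<^sup>n = 1\<close>.  Under left multiplication an involution of \<open>N\<close>
  is a product of \<open>n\<close> transpositions, hence an odd permutation, so the sign character of the regular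
  representation has a kernel of index 2, and this kernel is \<open>K\<close>
  (\<open>regular_sign_character\<close>).  Thus \<open>N = K \<rtimes> \<int>\<^sub>2\<close>, and \<open>K\<close> is characteristic.  A generator of
  \<open>\<int>\<^sub>n\<close> corresponds to some \<open>(x, \<alpha>)\<close> of order \<open>n\<close> in the regular subgroup of \<open>Hol(N)\<close>.  As \<open>n\<close> is
  odd, \<open>x\<close> lies in \<open>K\<close>, and the \<open>n\<close> distinct points of the orbit of 1 under \<open>(x, \<alpha>)\<close> fill \<open>K\<close>.  So
  \<open>K\<close>, a group of odd order, has a cyclic regular subgroup in its holomorph, and the claim is that
  such a \<open>K\<close> has the form \<open>\<int>\<^sub>k \<rtimes> \<int>\<^sub>l\<close> with \<open>k\<close>, \<open>l\<close> coprime.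

  The locale \<open>cyclic_transitive\<close> records this situation: the map \<open>y \<mapsto> x \<alpha>(y)\<close> moves 1 through the
  whole group.  It passes to \<open>\<alpha>\<close>-invariant subgroups (replace the map by its first return) and
  to quotients by \<open>\<alpha>\<close>-invariant normal subgroups.  Three facts then determine the group \<open>G\<close>.

  \<^item> If \<open>G\<close> is abelian of odd order, it is cyclic, generated by \<open>x\<close> (\<open>abelian_odd_generated\<close>).  The
    essential case is an elementary abelian \<open>p\<close>-group.  It is here that \<open>p\<close> must be odd: for
    \<open>p = 2\<close> the group \<open>\<int>\<^sub>2 \<times> \<int>\<^sub>2\<close> does have a cyclic regular subgroup in its holomorph.
  \<^item> The commutator subgroup \<open>D\<close> is abelian (\<open>derived_commute\<close>).  The group \<open>G \<rtimes> \<langle>\<alpha>\<rangle>\<close> is the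
    product of the cyclic groups \<open>\<langle>(x, \<alpha>)\<rangle>\<close> and \<open>\<langle>\<alpha>\<rangle>\<close>, and this is Ito's theorem on products of
    two abelian groups.
  \<^item> Applied to \<open>D\<close> and to \<open>G/D\<close>, the first fact shows that \<open>D\<close> is cyclic and \<open>G = D\<langle>x\<rangle>\<close>.  Since
    \<open>D\<close> is abelian, commutation with \<open>x\<close> permutes \<open>D\<close>, whence \<open>D \<inter> \<langle>x\<rangle> = 1\<close>.  A prime dividing
    both \<open>|D|\<close> and the order of \<open>x\<close> would produce an invariant section that is elementary abelian
    of order at least \<open>p\<^sup>2\<close>, against the first fact (\<open>coprime_derived_ord\<close>).
\<close>

section \<open>Cyclic transitive subgroups of the holomorph\<close>

text \<open>
  The pair \<open>(x, \<alpha>)\<close> stands for the element of the holomorph acting by \<open>z \<mapsto> x \<alpha>(z)\<close>.  This is a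
  permutation of a finite set, so once the orbit of 1 is everything the group it generates is
  regular.  The automorphism is taken as an injective endomorphism without extensionality, so
  that the same function can be used on the group, on its subgroups and, through images, on
  cosets.
\<close>

locale cyclic_transitive = group G for G (structure) +
  fixes x and \<alpha>
  assumes finite_carrier: "finite (carrier G)"
    and x_closed [simp, intro]: "x \<in> carrier G"
    and \<alpha>_hom: "\<alpha> \<in> hom G G"
    and \<alpha>_inj: "inj_on \<alpha> (carrier G)"
    and transitive: "y \<in> carrier G \<Longrightarrow> \<exists>i. y = ((\<lambda>z. x \<otimes> \<alpha> z) ^^ i) \<one>"
begin

definition step where "step z = x \<otimes> \<alpha> z"

text \<open>
  The point \<open>orb i\<close> is the \<open>i\<close>-th partial product of \<open>x \<alpha>(x) \<alpha>\<^sup>2(x) \<dots>\<close>, that is, the first component of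
  \<open>(x, \<alpha>)\<^sup>i\<close>; the second component is \<open>\<alpha>\<^sup>i\<close>.
\<close>

definition orb where "orb i = (step ^^ i) \<one>"

lemma hom_power: "\<alpha> ^^ i \<in> hom G G"
proof (induction i)
  case (Suc i)
  then show ?case using \<alpha>_hom by (auto simp: hom_def Pi_iff)
qed (simp add: hom_def)

lemma group_hom_power: "group_hom G G (\<alpha> ^^ i)"
  by (intro group_hom.intro group_hom_axioms.intro is_group hom_power)

lemmas power_closed [simp, intro] = group_hom.hom_closed[OF group_hom_power]
lemmas power_mult [simp] = group_hom.hom_mult[OF group_hom_power]
lemmas power_one [simp] = group_hom.hom_one[OF group_hom_power]
lemmas power_inv [simp] = group_hom.hom_inv[OF group_hom_power]
lemmas power_pow [simp] = group_hom.hom_nat_pow[OF group_hom_power]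

lemma group_hom_\<alpha>: "group_hom G G \<alpha>"
  using group_hom_power[of 1] by simp

lemmas \<alpha>_closed [simp, intro] = group_hom.hom_closed[OF group_hom_\<alpha>]
lemmas \<alpha>_mult [simp] = group_hom.hom_mult[OF group_hom_\<alpha>]
lemmas \<alpha>_one [simp] = group_hom.hom_one[OF group_hom_\<alpha>]
lemmas \<alpha>_inv [simp] = group_hom.hom_inv[OF group_hom_\<alpha>]
lemmas \<alpha>_pow [simp] = group_hom.hom_nat_pow[OF group_hom_\<alpha>]

lemma power_inj: "inj_on (\<alpha> ^^ i) (carrier G)"
proof (induction i)
  case (Suc i)
  have "(\<alpha> ^^ i) ` carrier G \<subseteq> carrier G" by auto
  then show ?case
    using comp_inj_on[OF Suc inj_on_subset[OF \<alpha>_inj]] unfolding funpow.simps by blast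
qed auto

lemma power_eq_iff [simp]:
  "y \<in> carrier G \<Longrightarrow> z \<in> carrier G \<Longrightarrow> (\<alpha> ^^ i) y = (\<alpha> ^^ i) z \<longleftrightarrow> y = z"
  using power_inj[of i] by (auto simp: inj_on_def)

lemma power_eq_one_iff [simp]: "y \<in> carrier G \<Longrightarrow> (\<alpha> ^^ i) y = \<one> \<longleftrightarrow> y = \<one>"
  using power_eq_iff[of y \<one> i] by simp

lemma power_surj: "(\<alpha> ^^ i) ` carrier G = carrier G"
  by (rule endo_inj_surj[OF finite_carrier _ power_inj]) auto

lemma invariant_image:
  assumes "L \<subseteq> carrier G" "\<alpha> ` L \<subseteq> L"
  shows "\<alpha> ` L = L"
  by (rule endo_inj_surj[OF finite_subset[OF assms(1) finite_carrier] assms(2)])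
    (rule inj_on_subset[OF \<alpha>_inj assms(1)])

lemma invariant_power_image:
  assumes "L \<subseteq> carrier G" "\<alpha> ` L \<subseteq> L"
  shows "(\<alpha> ^^ i) ` L = L"
proof (induction i)
  case (Suc i)
  have "(\<alpha> ^^ Suc i) ` L = \<alpha> ` ((\<alpha> ^^ i) ` L)" by auto
  then show ?case using Suc invariant_image[OF assms] by simp
qed simp

lemma step_closed [simp, intro]: "z \<in> carrier G \<Longrightarrow> step z \<in> carrier G"
  by (simp add: step_def)

lemma step_power_closed [simp, intro]: "z \<in> carrier G \<Longrightarrow> (step ^^ i) z \<in> carrier G"
  by (induction i) auto

lemma orb_closed [simp, intro]: "orb i \<in> carrier G"
  by (simp add: orb_def)

lemma orb_0 [simp]: "orb 0 = \<one>"
  by (simp add: orb_def)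

lemma orb_Suc: "orb (Suc i) = x \<otimes> \<alpha> (orb i)"
  by (simp add: orb_def step_def)

lemma orb_surj: "y \<in> carrier G \<Longrightarrow> \<exists>i. y = orb i"
  using transitive[of y] by (simp add: orb_def step_def[abs_def])

lemma step_power: "z \<in> carrier G \<Longrightarrow> (step ^^ i) z = orb i \<otimes> (\<alpha> ^^ i) z"
  by (induction i) (auto simp: orb_Suc step_def m_assoc)

lemma orb_add: "orb (i + j) = orb i \<otimes> (\<alpha> ^^ i) (orb j)"
  using step_power[of "orb j" i] by (simp add: orb_def funpow_add)

text \<open>
  Both sides are \<open>orb (i + j)\<close>.  This identity is all that will be used of the commutativity of the
  cyclic group generated by \<open>(x, \<alpha>)\<close>.
\<close>

lemma orb_commute: "orb i \<otimes> (\<alpha> ^^ i) (orb j) = orb j \<otimes> (\<alpha> ^^ j) (orb i)"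
  using orb_add[of i j] orb_add[of j i] by (simp add: add.commute)

lemma orb_return: obtains q where "q > 0" "orb q = \<one>"
proof -
  have "\<not> inj_on orb (UNIV :: nat set)"
    using finite_imageD[of orb UNIV] finite_subset[of "range orb", OF _ finite_carrier] by auto
  then obtain i j where "i < j" "orb i = orb j"
    by (metis linorder_inj_onI')
  then have "orb i = orb i \<otimes> (\<alpha> ^^ i) (orb (j - i))"
    using orb_add[of i "j - i"] by simp
  then have "orb (j - i) = \<one>"
    by simp
  with \<open>i < j\<close> that[of "j - i"] show thesis by simp
qed

text \<open>
  A power of \<open>step\<close> commutes with \<open>step\<close>, so by transitivity it fixes every point as soon as it
  fixes one, and then the orbit has at most \<open>q\<close> points.
\<close>

lemma order_le_period:
  assumes "y \<in> carrier G" "q > 0" "(step ^^ q) y = y"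
  shows "card (carrier G) \<le> q"
proof -
  obtain j where j: "y = orb j" using orb_surj assms(1) by blast
  have "orb j = orb q \<otimes> (\<alpha> ^^ q) (orb j)"
    using assms step_power[of y q] j by simp
  also have "\<dots> = orb j \<otimes> (\<alpha> ^^ j) (orb q)" by (rule orb_commute)
  finally have q: "orb q = \<one>" by simp
  have "(\<alpha> ^^ q) (orb i) = orb i" for i
    using orb_commute[of q i] q by simp
  then have shift: "orb (q + i) = orb i" for i
    using orb_add[of q i] q by simp
  have shift': "orb (q * k + i) = orb i" for k i
    by (induction k) (simp_all add: add.assoc shift)
  have "orb i = orb (i mod q)" for i
    using shift'[of "i div q" "i mod q"] by simp
  then have "carrier G \<subseteq> orb ` {..<q}"
    using orb_surj assms(2) by (metis image_eqI lessThan_iff mod_less_divisor subsetI)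
  then show ?thesis
    by (metis card_image_le card_lessThan card_mono finite_imageI finite_lessThan le_trans)
qed

text \<open>
  For the first return time \<open>m\<close> to \<open>L\<close>, the \<open>m\<close>-th power of \<open>step\<close> preserves \<open>L\<close>, and a visit
  \<open>orb j\<close> to \<open>L\<close> with \<open>j \<ge> m\<close> is its image of the earlier visit \<open>orb (j - m)\<close>.
\<close>

lemma subgroup_cyclic_transitive:
  assumes L: "subgroup L G" and inv: "\<alpha> ` L \<subseteq> L"
  obtains m where "cyclic_transitive (G\<lparr>carrier := L\<rparr>) (orb m) (\<alpha> ^^ m)"
proof -
  have sub: "L \<subseteq> carrier G" using L by (rule subgroup.subset)
  define P where "P q \<longleftrightarrow> q > 0 \<and> orb q \<in> L" for q
  define m where "m = (LEAST q. P q)"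
  obtain q where "q > 0" "orb q = \<one>" by (rule orb_return)
  then have "P q" using L by (auto simp: P_def subgroup.one_closed)
  then have m: "P m" unfolding m_def by (rule LeastI)
  then have m0: "m > 0" and mL: "orb m \<in> L" by (auto simp: P_def)
  have least: "\<not> P q" if "q < m" for q using that not_less_Least unfolding m_def by blast
  have power_L: "(\<alpha> ^^ m) y \<in> L \<longleftrightarrow> y \<in> L" if "y \<in> carrier G" for y
  proof -
    have im: "(\<alpha> ^^ m) ` L = L" by (rule invariant_power_image[OF sub inv])
    have "y \<in> L" if "(\<alpha> ^^ m) y \<in> (\<alpha> ^^ m) ` L"
      using inj_on_image_mem_iff[OF power_inj \<open>y \<in> carrier G\<close> sub] that by blast
    then show ?thesis using im by blast
  qed
  have reach: "\<exists>i. orb j = ((\<lambda>z. orb m \<otimes> (\<alpha> ^^ m) z) ^^ i) \<one>" if "orb j \<in> L" for j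
    using that
  proof (induction j rule: less_induct)
    case (less j)
    consider "j = 0" | "j > 0" "j < m" | "j \<ge> m" by linarith
    then show ?case
    proof cases
      case 1
      then show ?thesis by (intro exI[of _ 0]) simp
    next
      case 2
      then show ?thesis using least less.prems by (auto simp: P_def)
    next
      case 3
      then have j: "orb j = orb m \<otimes> (\<alpha> ^^ m) (orb (j - m))"
        using orb_add[of m "j - m"] by simp
      have "(\<alpha> ^^ m) (orb (j - m)) = inv (orb m) \<otimes> orb j"
        by (simp add: j flip: m_assoc)
      also have "\<dots> \<in> L"
        using L mL less.prems by (simp add: subgroup.m_closed subgroup.m_inv_closed)
      finally have "orb (j - m) \<in> L" by (simp add: power_L)
      then obtain i where "orb (j - m) = ((\<lambda>z. orb m \<otimes> (\<alpha> ^^ m) z) ^^ i) \<one>"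
        using less.IH[of "j - m"] m0 3 by (metis diff_less order_less_le_trans)
      then have "orb j = ((\<lambda>z. orb m \<otimes> (\<alpha> ^^ m) z) ^^ Suc i) \<one>"
        by (simp add: j)
      then show ?thesis by blast
    qed
  qed
  have "group (G\<lparr>carrier := L\<rparr>)"
    by (rule subgroup.subgroup_is_group[OF L is_group])
  moreover have "(\<alpha> ^^ m) \<in> hom (G\<lparr>carrier := L\<rparr>) (G\<lparr>carrier := L\<rparr>)"
    using sub power_L by (auto simp: hom_def subset_iff)
  ultimately have "cyclic_transitive (G\<lparr>carrier := L\<rparr>) (orb m) (\<alpha> ^^ m)"
  proof (intro cyclic_transitive.intro cyclic_transitive_axioms.intro)
    fix y assume y: "y \<in> carrier (G\<lparr>carrier := L\<rparr>)"
    then have "y \<in> carrier G" using sub by auto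
    then obtain j where "y = orb j" using orb_surj by blast
    then show "\<exists>i. y = ((\<lambda>z. orb m \<otimes>\<^bsub>G\<lparr>carrier := L\<rparr>\<^esub> (\<alpha> ^^ m) z) ^^ i) \<one>\<^bsub>G\<lparr>carrier := L\<rparr>\<^esub>"
      using reach[of j] y by simp
  qed (use mL finite_subset[OF sub finite_carrier] inj_on_subset[OF power_inj sub] in simp_all)
  then show thesis by (rule that)
qed

text \<open>
  On cosets the induced automorphism is taking images, because \<open>\<alpha> ` M = M\<close>.
\<close>

lemma quotient_cyclic_transitive:
  assumes M: "M \<lhd> G" and inv: "\<alpha> ` M \<subseteq> M"
  shows "cyclic_transitive (G Mod M) (M #> x) ((`) \<alpha>)"
proof -
  interpret M: normal M G by (rule M)
  interpret Q: group "G Mod M" by (rule M.factorgroup_is_group)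
  have im: "\<alpha> ` M = M" by (rule invariant_image[OF M.subset inv])
  have coset: "\<alpha> ` (M #> y) = M #> \<alpha> y" if "y \<in> carrier G" for y
  proof -
    have "\<alpha> ` (M #> y) = \<alpha> ` M #> \<alpha> y"
      using that M.subset by (auto simp: r_coset_def image_iff subset_iff) 
    then show ?thesis by (simp add: im)
  qed
  have hom: "(`) \<alpha> \<in> hom (G Mod M) (G Mod M)"
  proof (rule homI)
    fix A B assume "A \<in> carrier (G Mod M)" "B \<in> carrier (G Mod M)"
    then obtain y z where "A = M #> y" "B = M #> z" "y \<in> carrier G" "z \<in> carrier G"
      by (auto simp: carrier_FactGroup)
    then show "\<alpha> ` (A \<otimes>\<^bsub>G Mod M\<^esub> B) = \<alpha> ` A \<otimes>\<^bsub>G Mod M\<^esub> \<alpha> ` B"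
      by (simp add: M.rcos_sum coset)
  qed (auto simp: carrier_FactGroup coset)
  have fin: "finite (carrier (G Mod M))"
    by (simp add: carrier_FactGroup finite_carrier)
  have surj: "(`) \<alpha> ` carrier (G Mod M) = carrier (G Mod M)"
  proof -
    have "(`) \<alpha> ` carrier (G Mod M) = (\<lambda>y. M #> \<alpha> y) ` carrier G"
      by (auto simp: carrier_FactGroup coset image_image)
    also have "\<dots> = (\<lambda>y. M #> y) ` (\<alpha> ` carrier G)" by (simp add: image_image)
    finally show ?thesis using power_surj[of 1] by (simp add: carrier_FactGroup)
  qed
  have walk: "((\<lambda>z. (M #> x) \<otimes>\<^bsub>G Mod M\<^esub> \<alpha> ` z) ^^ i) M = M #> orb i" for i
    by (induction i) (auto simp: coset M.rcos_sum orb_Suc coset_mult_one M.subset)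
  have reach: "\<exists>i. A = ((\<lambda>z. (M #> x) \<otimes>\<^bsub>G Mod M\<^esub> \<alpha> ` z) ^^ i) \<one>\<^bsub>G Mod M\<^esub>"
    if A: "A \<in> carrier (G Mod M)" for A
  proof -
    obtain y where "y \<in> carrier G" "A = M #> y" using A by (auto simp: carrier_FactGroup)
    moreover from this obtain i where "y = orb i" using orb_surj by blast
    ultimately show ?thesis by (metis walk one_FactGroup)
  qed
  have "inj_on ((`) \<alpha>) (carrier (G Mod M))"
    using finite_surj_inj[OF fin, of "(`) \<alpha>"] surj by simp
  moreover have "M #> x \<in> carrier (G Mod M)"
    by (auto simp: carrier_FactGroup)
  ultimately show ?thesis
    using fin hom reach by (intro cyclic_transitive.intro cyclic_transitive_axioms.intro Q.is_group)
qed

end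

section \<open>Abelian groups of odd order\<close>

lemma (in group) ord_eq_prime:
  assumes "u \<in> carrier G" "u [^] p = \<one>" "u \<noteq> \<one>" "Factorial_Ring.prime (p :: nat)"
  shows "ord u = p"
  using assms by (metis ord_eq_1 pow_eq_id prime_nat_iff)

lemma (in comm_group) subgroup_powers: "subgroup ((\<lambda>z. z [^] (p::nat)) ` carrier G) G"
proof -
  have "(\<lambda>z. z [^] p) \<in> hom G G"
    by (rule homI) (auto simp: nat_pow_distrib)
  then show ?thesis
    by (intro group_hom.img_is_subgroup group_hom.intro group_hom_axioms.intro is_group)
qed

text \<open>
  Write \<open>N = \<alpha> - 1\<close>.  If \<open>x = k + N z\<close> with \<open>N k = 0\<close>, then after translating the origin to \<open>-z\<close> the
  map \<open>step\<close> becomes translation by \<open>k\<close>, so its orbits have at most \<open>p\<close> elements and \<open>|G| \<le> p\<close>.  Such a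
  decomposition exists if \<open>ker N\<close> meets the image of \<open>N\<close> trivially.  To see this, consider
  \<open>W = ker N\<^sup>2\<close> with its first return map \<open>w + \<alpha>\<^sup>m(z)\<close>: the \<open>i\<close>-th iterate of 0 is
  \<open>i w + m (i choose 2) N w\<close>, which vanishes for \<open>i = p\<close> because \<open>p\<close> is odd.  Hence \<open>|W| \<le> p\<close>, so
  that \<open>ker N\<close> is either trivial or all of \<open>W\<close>.
\<close>

lemma (in cyclic_transitive) elementary_abelian_generated:
  assumes comm: "comm_group G" and p: "Factorial_Ring.prime (p::nat)" "odd p"
    and exponent: "\<And>y. y \<in> carrier G \<Longrightarrow> y [^] p = \<one>"
  shows "generate G {x} = carrier G"
proof -
  interpret C: comm_group G by (rule comm)
  define N where "N z = \<alpha> z \<otimes> inv z" for z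
  have N_hom: "N \<in> hom G G"
    by (rule homI) (auto simp: N_def C.m_ac C.inv_mult)
  interpret N: group_hom G G N
    by (intro group_hom.intro group_hom_axioms.intro is_group N_hom)
  have \<alpha>_eq: "\<alpha> z = z \<otimes> N z" if "z \<in> carrier G" for z
    using that by (simp add: N_def C.m_comm[of z] m_assoc)
  have N_\<alpha>: "N (\<alpha> z) = \<alpha> (N z)" if "z \<in> carrier G" for z
    using that by (simp add: N_def)
  have p0: "p > 0" using p(1) by (simp add: prime_gt_0_nat)

  define W where "W = {w \<in> carrier G. N (N w) = \<one>}"
  have card_W: "card W \<le> p"
  proof -
    have sub: "subgroup W G"
      by (rule subgroupI) (auto simp: W_def intro!: exI[of _ \<one>])
    have "\<alpha> ` W \<subseteq> W" by (auto simp: W_def N_\<alpha>)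
    then obtain m where "cyclic_transitive (G\<lparr>carrier := W\<rparr>) (orb m) (\<alpha> ^^ m)"
      using subgroup_cyclic_transitive[OF sub] by blast
    then interpret S: cyclic_transitive "G\<lparr>carrier := W\<rparr>" "orb m" "\<alpha> ^^ m" .
    define w where "w = orb m"
    have w [simp]: "w \<in> carrier G" "N (N w) = \<one>"
      using S.x_closed by (auto simp: W_def w_def)
    have pw: "(\<alpha> ^^ k) w = w \<otimes> N w [^] k" for k
      by (induction k) (auto simp: \<alpha>_eq C.m_ac N.hom_nat_pow)
    have pNw: "(\<alpha> ^^ k) (N w) = N w" for k
      by (induction k) (auto simp: \<alpha>_eq)
    have "S.orb i = w [^] i \<otimes> N w [^] (m * (i choose 2))" for i
    proof (induction i)
      case (Suc i)
      have "S.orb (Suc i) = w \<otimes> (\<alpha> ^^ m) (w [^] i \<otimes> N w [^] (m * (i choose 2)))"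
        by (simp add: S.orb_Suc Suc w_def)
      also have "\<dots> = w \<otimes> ((w \<otimes> N w [^] m) [^] i \<otimes> N w [^] (m * (i choose 2)))"
        by (simp add: pw pNw)
      also have "\<dots> = w [^] Suc i \<otimes> N w [^] (m * i + m * (i choose 2))"
        by (simp add: C.nat_pow_distrib nat_pow_pow C.m_ac flip: nat_pow_mult)
      also have "m * i + m * (i choose 2) = m * (Suc i choose 2)"
        by (simp add: numeral_2_eq_2 algebra_simps)
      finally show ?case .
    qed (simp add: numeral_2_eq_2)
    moreover have "p dvd m * (p choose 2)"
    proof -
      obtain b where b: "p = 2 * b + 1" using p(2) by (elim oddE)
      then have "p choose 2 = p * b" by (simp add: choose_two)
      then show ?thesis by simp
    qed
    then have "N w [^] (m * (p choose 2)) = \<one>"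
      using exponent[of "N w"] by (elim dvdE) (simp flip: nat_pow_pow)
    ultimately have "S.orb p = \<one>"
      using exponent[of w] by simp
    then show "card W \<le> p"
      using S.order_le_period[of \<one> p] p0 subgroup.one_closed[OF sub] by (simp add: S.orb_def)
  qed

  \<comment> \<open>A nontrivial element of \<open>ker N \<inter> im N\<close> has order \<open>p\<close>, which forces \<open>ker N = ker N\<^sup>2\<close>.\<close>
  have fix_image: "u = \<one>" if u_mem: "u \<in> N ` carrier G" and Nu: "N u = \<one>" for u
  proof (rule ccontr)
    assume u1: "u \<noteq> \<one>"
    obtain z where z: "z \<in> carrier G" "u = N z" using u_mem by blast
    define F where "F = {w \<in> carrier G. N w = \<one>}"
    have F: "subgroup F G"
      by (rule subgroupI) (auto simp: F_def intro!: exI[of _ \<one>])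
    have u: "u \<in> carrier G" using z by simp
    have "generate G {u} \<subseteq> F"
      by (rule generate_subgroup_incl[OF _ F]) (use Nu u in \<open>auto simp: F_def\<close>)
    then have "ord u \<le> card F"
      using generate_pow_card[OF u] card_mono[of F "generate G {u}"] finite_carrier
      by (simp add: F_def)
    then have "p \<le> card F"
      using ord_eq_prime[OF u exponent[OF u] u1 p(1)] by simp
    moreover have "F \<subseteq> W" "finite W" by (auto simp: F_def W_def finite_carrier)
    ultimately have "F = W" using card_W card_seteq[of W F] by simp
    moreover have "z \<in> W" using Nu z by (simp add: W_def)
    ultimately have "z \<in> F" by simp
    then show False using z u1 by (simp add: F_def)
  qed

  obtain z where z: "z \<in> carrier G" "N x = N (N z)"
  proof -
    have "inj_on N (N ` carrier G)"
    proof (rule inj_onI)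
      fix u v assume uv: "u \<in> N ` carrier G" "v \<in> N ` carrier G" "N u = N v"
      then have "u \<in> carrier G" "v \<in> carrier G" by auto
      moreover from this uv have "N (u \<otimes> inv v) = \<one>" by simp
      moreover from uv have "u \<otimes> inv v \<in> N ` carrier G"
        by (auto simp flip: N.hom_inv N.hom_mult)
      ultimately show "u = v" using fix_image[of "u \<otimes> inv v"] inv_equality[of u "inv v"] by simp
    qed
    then have "N ` N ` carrier G = N ` carrier G"
      by (intro endo_inj_surj) (auto simp: finite_carrier)
    then have "N x \<in> N ` N ` carrier G" by simp
    then show thesis using that by auto
  qed
  define k where "k = x \<otimes> inv (N z)"
  have k: "k \<in> carrier G" "N k = \<one>" using z by (auto simp: k_def)
  have x_eq: "x = k \<otimes> N z" using z by (simp add: k_def m_assoc)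
  \<comment> \<open>In the new origin \<open>inv z\<close> the map \<open>step\<close> is multiplication by \<open>k\<close>.\<close>
  have \<alpha>k: "\<alpha> k = k" using \<alpha>_eq[OF k(1)] k by simp
  have rearrange: "k \<otimes> (A \<otimes> Z) \<otimes> (c \<otimes> B) = (A \<otimes> B) \<otimes> (c \<otimes> k \<otimes> Z)"
    if "A \<in> carrier G" "B \<in> carrier G" "c \<in> carrier G" "Z \<in> carrier G" for A B c Z
    using that k(1) by (simp add: C.m_ac)
  have "step (k [^] i \<otimes> inv z) = k [^] Suc i \<otimes> inv z" for i
  proof -
    have "step (k [^] i \<otimes> inv z) = x \<otimes> (k [^] i \<otimes> inv (\<alpha> z))"
      using z(1) k(1) by (simp add: step_def \<alpha>k)
    also have "\<dots> = k \<otimes> (\<alpha> z \<otimes> inv z) \<otimes> (k [^] i \<otimes> inv (\<alpha> z))"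
      using x_eq by (simp only: N_def)
    also have "\<dots> = k [^] Suc i \<otimes> inv z"
      using z(1) k(1) by (simp add: rearrange)
    finally show ?thesis .
  qed
  then have "(step ^^ i) (inv z) = k [^] i \<otimes> inv z" for i
    using z by (induction i) auto
  then have "card (carrier G) \<le> p"
    using order_le_period[of "inv z" p] z k exponent p0 by simp
  show ?thesis
  proof (cases "x = \<one>")
    case True
    have "orb i = \<one>" for i
    proof (induction i)
      case (Suc i)
      then have "orb (Suc i) = x" by (simp add: orb_Suc)
      then show ?case using True by (rule trans)
    qed simp
    then have "carrier G = {\<one>}" using orb_surj by (metis insertI1 one_closed singletonD subsetI subset_singletonD empty_iff)
    then show ?thesis using True generate_one by simp
  next
    case False
    then have "card (generate G {x}) = p"
      using ord_eq_prime[OF x_closed exponent False p(1)] generate_pow_card[of x] by simp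
    then show ?thesis
      using \<open>card (carrier G) \<le> p\<close> generate_incl[of "{x}"] finite_carrier
      by (intro card_seteq) auto
  qed
qed

text \<open>
  The elementary abelian case, applied to \<open>G/pG\<close>, gives \<open>G = pG + \<langle>x\<rangle>\<close> for every odd prime \<open>p\<close>.
  Iterating over the prime factors of an odd \<open>d\<close> gives \<open>G = dG + \<langle>x\<rangle>\<close>, and \<open>d = |G|\<close> kills the first
  summand.
\<close>

lemma (in cyclic_transitive) abelian_odd_generated:
  assumes comm: "comm_group G" and odd: "odd (order G)"
  shows "generate G {x} = carrier G"
proof -
  interpret C: comm_group G by (rule comm)
  let ?B = "generate G {x}"
  have B: "subgroup ?B G" by (rule generate_is_subgroup) simp
  have prime_case: "\<exists>z\<in>carrier G. \<exists>b\<in>?B. y = z [^] p \<otimes> b"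
    if p: "Factorial_Ring.prime p" "odd p" and y: "y \<in> carrier G" for p :: nat and y
  proof -
    define M where "M = (\<lambda>z. z [^] p) ` carrier G"
    have "subgroup M G"
      unfolding M_def by (rule C.subgroup_powers)
    then have M: "M \<lhd> G" by (rule C.subgroup_imp_normal)
    interpret M: normal M G by (rule M)
    have "\<alpha> ` M \<subseteq> M" by (auto simp: M_def)
    then interpret Q: cyclic_transitive "G Mod M" "M #> x" "(`) \<alpha>"
      by (rule quotient_cyclic_transitive[OF M])
    have "comm_group (G Mod M)"
      by (rule C.abelian_FactGroup) (rule M.subgroup_axioms)
    moreover have "A [^]\<^bsub>G Mod M\<^esub> p = \<one>\<^bsub>G Mod M\<^esub>" if A: "A \<in> carrier (G Mod M)" for A
    proof -
      obtain a where "a \<in> carrier G" "A = M #> a" using A by (auto simp: carrier_FactGroup)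
      moreover from this have "a [^] p \<in> M" by (auto simp: M_def)
      ultimately show ?thesis by (simp add: M.FactGroup_pow M.rcos_const is_group)
    qed
    ultimately have "generate (G Mod M) {M #> x} = carrier (G Mod M)"
      using p by (intro Q.elementary_abelian_generated)
    then have "M #> y \<in> generate (G Mod M) {M #> x}"
      using y by (simp add: carrier_FactGroup)
    then obtain i :: int where "M #> y = M #> (x [^] i)"
      by (auto simp: Q.generate_pow M.FactGroup_int_pow)
    then have "y \<in> M #> (x [^] i)" using rcos_self[OF y M.subgroup_axioms] by simp
    then obtain z where "z \<in> carrier G" "y = z [^] p \<otimes> x [^] i"
      by (auto simp: r_coset_def M_def)
    moreover have "x [^] i \<in> ?B" by (auto simp: generate_pow)
    ultimately show ?thesis by blast
  qed
  have "\<forall>y\<in>carrier G. \<exists>z\<in>carrier G. \<exists>b\<in>?B. y = z [^] d \<otimes> b" if "odd d" for d :: nat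
    using that
  proof (induction d rule: less_induct)
    case (less d)
    show ?case
    proof (cases "d = 1")
      case True
      show ?thesis
        by (intro ballI bexI[of _ \<one>] bexI) (use True subgroup.one_closed[OF B] in auto)
    next
      case False
      then obtain p where p: "Factorial_Ring.prime p" "p dvd d" using prime_factor_nat by blast
      then obtain e where e: "d = p * e" by blast
      from e less.prems have "odd p" "odd e" "e > 0" by (auto intro: odd_pos)
      then have "e < d" using e p prime_gt_1_nat by auto
      show ?thesis
      proof
        fix y assume "y \<in> carrier G"
        then obtain z b where zb: "z \<in> carrier G" "b \<in> ?B" "y = z [^] e \<otimes> b"
          using less.IH[OF \<open>e < d\<close> \<open>odd e\<close>] by blast
        obtain w c where wc: "w \<in> carrier G" "c \<in> ?B" "z = w [^] p \<otimes> c"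
          using prime_case[OF p(1) \<open>odd p\<close> zb(1)] by blast
        have bc: "b \<in> carrier G" "c \<in> carrier G" using zb wc B subgroup.subset by blast+
        have "c [^] e \<in> ?B"
          using subgroup_int_pow_closed[OF B wc(2), of "int e"] by (simp add: int_pow_int)
        then have "c [^] e \<otimes> b \<in> ?B" using subgroup.m_closed[OF B] zb by blast
        moreover have "y = w [^] d \<otimes> (c [^] e \<otimes> b)"
          using zb wc bc by (simp add: e C.nat_pow_distrib nat_pow_pow m_assoc)
        ultimately show "\<exists>z\<in>carrier G. \<exists>b\<in>?B. y = z [^] d \<otimes> b"
          using wc(1) by blast
      qed
    qed
  qed
  from this[OF odd] have "carrier G \<subseteq> ?B"
    using B by (auto simp: pow_order_eq_1 subgroup.mem_carrier)
  then show ?thesis using subgroup.subset[OF B] by blast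
qed

section \<open>Commutators commute\<close>

lemma (in group) inv_mult_cancel:
  assumes "a \<in> carrier G" "b \<in> carrier G"
  shows "inv a \<otimes> (a \<otimes> b) = b" "a \<otimes> (inv a \<otimes> b) = b"
  using assms by (simp_all flip: m_assoc)

lemma (in group) subgroup_centralizer:
  assumes "S \<subseteq> carrier G"
  shows "subgroup {z \<in> carrier G. \<forall>s\<in>S. z \<otimes> s = s \<otimes> z} G"
proof (rule subgroupI)
  fix a assume a: "a \<in> {z \<in> carrier G. \<forall>s\<in>S. z \<otimes> s = s \<otimes> z}"
  have "inv a \<otimes> s = s \<otimes> inv a" if "s \<in> S" for s
  proof -
    have "s \<in> carrier G" "a \<in> carrier G" "a \<otimes> s = s \<otimes> a" using assms a that by auto
    then show ?thesis by (metis inv_closed inv_solve_left inv_solve_right m_assoc m_closed)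
  qed
  then show "inv a \<in> {z \<in> carrier G. \<forall>s\<in>S. z \<otimes> s = s \<otimes> z}" using a by auto
next
  fix a b
  assume "a \<in> {z \<in> carrier G. \<forall>s\<in>S. z \<otimes> s = s \<otimes> z}" "b \<in> {z \<in> carrier G. \<forall>s\<in>S. z \<otimes> s = s \<otimes> z}"
  then show "a \<otimes> b \<in> {z \<in> carrier G. \<forall>s\<in>S. z \<otimes> s = s \<otimes> z}"
    using assms by (auto simp: subset_iff) (metis m_assoc)
qed (use assms in \<open>auto intro!: exI[of _ \<one>]\<close>)

lemma (in group) generate_commute:
  assumes S: "S \<subseteq> carrier G" and comm: "\<And>s t. s \<in> S \<Longrightarrow> t \<in> S \<Longrightarrow> s \<otimes> t = t \<otimes> s"
    and u: "u \<in> generate G S" and v: "v \<in> generate G S"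
  shows "u \<otimes> v = v \<otimes> u"
proof -
  have "generate G S \<subseteq> {z \<in> carrier G. \<forall>s\<in>S. z \<otimes> s = s \<otimes> z}"
    using S comm by (intro generate_subgroup_incl subgroup_centralizer) auto
  then have "S \<subseteq> {z \<in> carrier G. \<forall>s\<in>generate G S. z \<otimes> s = s \<otimes> z}"
    using S by (auto simp: subset_iff)
  then have "generate G S \<subseteq> {z \<in> carrier G. \<forall>s\<in>generate G S. z \<otimes> s = s \<otimes> z}"
    by (intro generate_subgroup_incl subgroup_centralizer generate_incl S)
  then show ?thesis using u v by auto
qed

context cyclic_transitive
begin

lemma power_commute: "(\<alpha> ^^ i) ((\<alpha> ^^ j) y) = (\<alpha> ^^ j) ((\<alpha> ^^ i) y)"
  by (metis add.commute comp_apply funpow_add)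

text \<open>
  The displacements are the commutators of \<open>\<alpha>\<^sup>b\<close> with \<open>y\<close> in \<open>G \<rtimes> \<langle>\<alpha>\<rangle>\<close>; equivalently, the commutators
  of \<open>\<langle>\<alpha>\<rangle>\<close> with the cyclic regular subgroup.
\<close>

definition displacement where "displacement b y = (\<alpha> ^^ b) y \<otimes> inv y"

lemma displacement_closed [simp, intro]: "y \<in> carrier G \<Longrightarrow> displacement b y \<in> carrier G"
  by (simp add: displacement_def)

lemma power_displacement:
  "y \<in> carrier G \<Longrightarrow> (\<alpha> ^^ i) (displacement b y) = displacement b ((\<alpha> ^^ i) y)"
  by (simp add: displacement_def power_commute)

text \<open>
  Conjugation by \<open>(orb j, \<alpha>\<^sup>j)\<close> replaces the exponent \<open>b\<close> by some \<open>b + k\<close> which does not depend on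
  \<open>y\<close>.  In Ito's proof this corresponds to conjugating the commutator of \<open>\<alpha>\<^sup>b\<close> and \<open>c\<close>, where \<open>c\<close>
  lies in the cyclic regular subgroup \<open>C\<close>, by another element of \<open>C\<close>: the conjugate of \<open>\<alpha>\<^sup>b\<close> is
  a power \<open>\<alpha>\<^bsup>b+k\<^esup>\<close> times an element of \<open>C\<close>, and the latter commutes with \<open>c\<close>.  The index \<open>k\<close> is the
  position in the orbit of the element \<open>K\<close> chosen in the proof.
\<close>

lemma orb_conj_displacement:
  "\<exists>k. \<forall>y\<in>carrier G. orb j \<otimes> (\<alpha> ^^ j) (displacement b y) \<otimes> inv (orb j) = displacement (b + k) y"
proof -
  define S where "S = orb j"
  have S [simp]: "S \<in> carrier G" by (simp add: S_def)
  have "(\<alpha> ^^ b) S \<otimes> inv S \<in> (\<alpha> ^^ b) ` carrier G" unfolding power_surj by simp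
  then obtain K where K: "K \<in> carrier G" "(\<alpha> ^^ b) K = (\<alpha> ^^ b) S \<otimes> inv S" by auto
  then obtain k where k: "K = orb k" using orb_surj by blast
  have "S \<otimes> (\<alpha> ^^ j) (displacement b y) \<otimes> inv S = displacement (b + k) y"
    if y: "y \<in> carrier G" for y
  proof -
    obtain l where l: "y = orb l" using orb_surj y by blast
    define P where "P = (\<alpha> ^^ j) y"
    define Q where "Q = (\<alpha> ^^ l) S"
    define R where "R = (\<alpha> ^^ (b + k)) y"
    have cl [simp]: "P \<in> carrier G" "Q \<in> carrier G" "R \<in> carrier G" "y \<in> carrier G"
      using y by (simp_all add: P_def Q_def R_def)
    have SP: "S \<otimes> P = y \<otimes> Q"
      using orb_commute[of j l] by (simp add: S_def P_def Q_def l)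
    have "(\<alpha> ^^ b) (K \<otimes> (\<alpha> ^^ k) y) = (\<alpha> ^^ b) (y \<otimes> (\<alpha> ^^ l) K)"
      using orb_commute[of k l] by (simp add: k l)
    then have "(\<alpha> ^^ b) S \<otimes> inv S \<otimes> R = (\<alpha> ^^ b) y \<otimes> (\<alpha> ^^ l) ((\<alpha> ^^ b) K)"
      using K by (simp add: R_def funpow_add power_commute[of b l])
    also have "(\<alpha> ^^ l) ((\<alpha> ^^ b) K) = (\<alpha> ^^ b) Q \<otimes> inv Q"
      using K(2) by (simp add: Q_def power_commute[of l b])
    also have "(\<alpha> ^^ b) y \<otimes> ((\<alpha> ^^ b) Q \<otimes> inv Q) = (\<alpha> ^^ b) (S \<otimes> P) \<otimes> inv Q"
      unfolding SP by (simp add: m_assoc)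
    finally have "(\<alpha> ^^ b) S \<otimes> (inv S \<otimes> R) = (\<alpha> ^^ b) S \<otimes> ((\<alpha> ^^ b) P \<otimes> inv Q)"
      by (simp add: m_assoc)
    then have "inv S \<otimes> R = (\<alpha> ^^ b) P \<otimes> inv Q"
      by simp
    then have "R = S \<otimes> ((\<alpha> ^^ b) P \<otimes> inv Q)"
      by (simp add: inv_solve_left')
    then have "R \<otimes> inv y = S \<otimes> (\<alpha> ^^ b) P \<otimes> inv (y \<otimes> Q)"
      by (simp add: inv_mult_group m_assoc)
    also have "\<dots> = S \<otimes> ((\<alpha> ^^ b) P \<otimes> inv P) \<otimes> inv S"
      by (simp add: inv_mult_group m_assoc flip: SP)
    also have "(\<alpha> ^^ b) P \<otimes> inv P = (\<alpha> ^^ j) (displacement b y)"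
      by (simp add: displacement_def P_def power_commute[of b j])
    finally show ?thesis by (simp add: displacement_def R_def)
  qed
  then show ?thesis unfolding S_def by blast
qed

text \<open>
  By the preceding lemma, conjugation by \<open>(inv u, \<alpha>\<^sup>j)\<close>, where \<open>orb j = inv u\<close>, changes only the
  exponent of a displacement, while \<open>\<alpha>\<^sup>g\<close> changes only its argument.  So the two operations commute
  on displacements, and comparing the two orders shows that \<open>\<alpha>\<^sup>g(u) \<cdot> inv u\<close> centralizes
  every displacement.
\<close>

lemma displacement_commute:
  assumes u: "u \<in> carrier G" and v: "v \<in> carrier G"
  shows "displacement g u \<otimes> displacement b v = displacement b v \<otimes> displacement g u"
proof -
  obtain j where j: "inv u = orb j" using orb_surj u by blast
  obtain k where k: "\<And>y. y \<in> carrier G \<Longrightarrow>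
      inv u \<otimes> (\<alpha> ^^ j) (displacement b y) \<otimes> inv (inv u) = displacement (b + k) y"
    using orb_conj_displacement[of j b] j by auto
  have "v \<in> (\<alpha> ^^ (j + g)) ` carrier G" using v by (simp only: power_surj)
  then obtain y where y: "y \<in> carrier G" "v = (\<alpha> ^^ j) ((\<alpha> ^^ g) y)"
    by (auto simp: funpow_add)
  define e where "e = displacement b v"
  have e: "e \<in> carrier G" "e = (\<alpha> ^^ j) (displacement b ((\<alpha> ^^ g) y))"
    "e = (\<alpha> ^^ g) ((\<alpha> ^^ j) (displacement b y))"
    using v y by (auto simp: e_def power_displacement power_commute[of g j])
  have "(\<alpha> ^^ g) (inv u \<otimes> (\<alpha> ^^ j) (displacement b y) \<otimes> inv (inv u))
      = displacement (b + k) ((\<alpha> ^^ g) y)"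
    using y(1) by (subst k) (simp_all add: power_displacement)
  also have "\<dots> = inv u \<otimes> e \<otimes> u"
    using k[of "(\<alpha> ^^ g) y"] y u by (simp add: e(2))
  finally have conj_eq: "inv ((\<alpha> ^^ g) u) \<otimes> e \<otimes> (\<alpha> ^^ g) u = inv u \<otimes> e \<otimes> u"
    using y u by (simp add: e(3))
  have "e \<otimes> displacement g u = (\<alpha> ^^ g) u \<otimes> (inv ((\<alpha> ^^ g) u) \<otimes> e \<otimes> (\<alpha> ^^ g) u) \<otimes> inv u"
    using u e(1) by (simp add: displacement_def m_assoc inv_mult_cancel)
  also have "inv ((\<alpha> ^^ g) u) \<otimes> e \<otimes> (\<alpha> ^^ g) u = inv u \<otimes> e \<otimes> u"
    by (rule conj_eq)
  also have "(\<alpha> ^^ g) u \<otimes> (inv u \<otimes> e \<otimes> u) \<otimes> inv u = displacement g u \<otimes> e"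
    using u e(1) by (simp add: displacement_def m_assoc)
  finally show ?thesis by (simp add: e_def)
qed

text \<open>
  The displacements generate a normal abelian subgroup \<open>D\<close>.  Modulo \<open>D\<close> the automorphism \<open>\<alpha>\<close> acts
  trivially, so there \<open>orb i\<close> is just \<open>x\<^sup>i\<close> and the quotient is cyclic.  Hence \<open>D\<close> contains the
  commutator subgroup.
\<close>

theorem derived_commute:
  assumes "u \<in> derived G (carrier G)" "v \<in> derived G (carrier G)"
  shows "u \<otimes> v = v \<otimes> u"
proof -
  define S where "S = {displacement b y | b y. y \<in> carrier G}"
  define D where "D = generate G S"
  have S: "S \<subseteq> carrier G" by (auto simp: S_def)
  have S_D: "displacement b y \<in> D" if "y \<in> carrier G" for b y
    unfolding D_def by (rule generate.incl) (use that in \<open>auto simp: S_def\<close>)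
  have sub: "subgroup D G" unfolding D_def by (rule generate_is_subgroup[OF S])
  have mem: "w \<in> carrier G" if "w \<in> D" for w using sub that by (rule subgroup.mem_carrier)
  \<comment> \<open>With \<open>z = \<alpha>\<^sup>b(w)\<close>, the conjugate is the quotient of the displacements of \<open>w y\<close> and of \<open>w\<close>.\<close>
  have conj: "z \<otimes> displacement b y \<otimes> inv z \<in> D" if z: "z \<in> carrier G" and y: "y \<in> carrier G" for z y b
  proof -
    have "z \<in> (\<alpha> ^^ b) ` carrier G" using z by (simp only: power_surj)
    then obtain w where w: "w \<in> carrier G" "z = (\<alpha> ^^ b) w" by auto
    have "z \<otimes> displacement b y \<otimes> inv z = displacement b (w \<otimes> y) \<otimes> inv (displacement b w)"
      using w y by (simp add: displacement_def inv_mult_group m_assoc inv_mult_cancel)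
    also have "\<dots> \<in> D"
      using w y S_D by (intro subgroup.m_closed[OF sub] subgroup.m_inv_closed[OF sub]) auto
    finally show ?thesis .
  qed
  have "{w \<in> carrier G. \<forall>z\<in>carrier G. z \<otimes> w \<otimes> inv z \<in> D} \<supseteq> D"
    unfolding D_def
  proof (rule generate_subgroup_incl)
    show "S \<subseteq> {w \<in> carrier G. \<forall>z\<in>carrier G. z \<otimes> w \<otimes> inv z \<in> generate G S}"
      using conj by (auto simp: S_def D_def)
    show "subgroup {w \<in> carrier G. \<forall>z\<in>carrier G. z \<otimes> w \<otimes> inv z \<in> generate G S} G"
      unfolding D_def[symmetric]
    proof (rule subgroupI)
      fix a b assume "a \<in> {w \<in> carrier G. \<forall>z\<in>carrier G. z \<otimes> w \<otimes> inv z \<in> D}"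
        and "b \<in> {w \<in> carrier G. \<forall>z\<in>carrier G. z \<otimes> w \<otimes> inv z \<in> D}"
      then have ab: "a \<in> carrier G" "b \<in> carrier G"
        "\<And>z. z \<in> carrier G \<Longrightarrow> (z \<otimes> a \<otimes> inv z) \<otimes> (z \<otimes> b \<otimes> inv z) \<in> D"
        using subgroup.m_closed[OF sub] by auto
      have "(z \<otimes> a \<otimes> inv z) \<otimes> (z \<otimes> b \<otimes> inv z) = z \<otimes> (a \<otimes> b) \<otimes> inv z" if "z \<in> carrier G" for z
        using ab that by (simp add: m_assoc inv_mult_cancel)
      with ab show "a \<otimes> b \<in> {w \<in> carrier G. \<forall>z\<in>carrier G. z \<otimes> w \<otimes> inv z \<in> D}" by auto
    next
      fix a assume "a \<in> {w \<in> carrier G. \<forall>z\<in>carrier G. z \<otimes> w \<otimes> inv z \<in> D}"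
      then have a: "a \<in> carrier G" "\<And>z. z \<in> carrier G \<Longrightarrow> inv (z \<otimes> a \<otimes> inv z) \<in> D"
        using subgroup.m_inv_closed[OF sub] by auto
      have "inv (z \<otimes> a \<otimes> inv z) = z \<otimes> inv a \<otimes> inv z" if "z \<in> carrier G" for z
        using a that by (simp add: m_assoc inv_mult_group)
      with a show "inv a \<in> {w \<in> carrier G. \<forall>z\<in>carrier G. z \<otimes> w \<otimes> inv z \<in> D}" by auto
    qed (use subgroup.one_closed[OF sub] in \<open>auto intro!: exI[of _ \<one>]\<close>)
  qed
  then have D: "D \<lhd> G"
    by (intro normal_invI[OF sub]) auto
  interpret D: normal D G by (rule D)
  interpret Q: group "G Mod D" by (rule D.factorgroup_is_group)
  have orb: "D #> orb i = (D #> x) [^]\<^bsub>G Mod D\<^esub> i" for i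
  proof (induction i)
    case (Suc i)
    have "\<alpha> (orb i) = displacement 1 (orb i) \<otimes> orb i"
      by (simp add: displacement_def m_assoc)
    then have "D #> \<alpha> (orb i) = D #> orb i"
      using S_D[of "orb i" 1] coset_mult_assoc[of D "displacement 1 (orb i)" "orb i"]
        D.rcos_const[OF is_group, of "displacement 1 (orb i)"] D.subset by simp
    moreover have "D #> orb (Suc i) = (D #> x) <#> (D #> \<alpha> (orb i))"
      by (simp add: orb_Suc D.rcos_sum)
    ultimately show ?case
      using Suc Q.nat_pow_Suc2[of "D #> x" i] by (simp add: carrier_FactGroup)
  qed (simp add: coset_mult_one D.subset)
  have "comm_group (G Mod D)"
  proof (rule Q.group_comm_groupI)
    fix A B assume AB: "A \<in> carrier (G Mod D)" "B \<in> carrier (G Mod D)"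
    then obtain a b where "a \<in> carrier G" "b \<in> carrier G" "A = D #> a" "B = D #> b"
      by (auto simp: carrier_FactGroup)
    moreover from this obtain i j where "a = orb i" "b = orb j" using orb_surj by meson
    ultimately have "A = (D #> x) [^]\<^bsub>G Mod D\<^esub> i" "B = (D #> x) [^]\<^bsub>G Mod D\<^esub> j"
      by (simp_all add: orb)
    then show "A \<otimes>\<^bsub>G Mod D\<^esub> B = B \<otimes>\<^bsub>G Mod D\<^esub> A"
      using Q.nat_pow_comm[of "D #> x" i j] by (auto simp: carrier_FactGroup simp del: mult_FactGroup)
  qed
  then have "derived G (carrier G) \<subseteq> D"
    by (rule derived_minimal[OF D])
  then have "u \<in> generate G S" "v \<in> generate G S"
    using assms by (auto simp: D_def)
  moreover have "s \<otimes> t = t \<otimes> s" if "s \<in> S" "t \<in> S" for s t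
    using that by (auto simp: S_def displacement_commute)
  ultimately show ?thesis
    by (rule generate_commute[OF S, rotated])
qed

end

section \<open>Groups of odd order with a cyclic regular subgroup in the holomorph\<close>

lemma (in group) commute_int_pow:
  assumes "a \<in> carrier G" "b \<in> carrier G" "a \<otimes> b = b \<otimes> a"
  shows "a \<otimes> b [^] (i::int) = b [^] i \<otimes> a"
proof -
  have "subgroup {z \<in> carrier G. \<forall>s\<in>{a}. z \<otimes> s = s \<otimes> z} G"
    by (rule subgroup_centralizer) (use assms in auto)
  then have "b [^] i \<in> {z \<in> carrier G. \<forall>s\<in>{a}. z \<otimes> s = s \<otimes> z}"
    by (rule subgroup_int_pow_closed) (use assms in auto)
  then show ?thesis by simp
qed

lemma (in group) conj_hom:
  "y \<in> carrier G \<Longrightarrow> group_hom G G (\<lambda>z. y \<otimes> z \<otimes> inv y)"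
  by (intro group_hom.intro group_hom_axioms.intro is_group homI)
    (auto simp: m_assoc inv_mult_cancel)

context cyclic_transitive
begin

abbreviation D where "D \<equiv> derived G (carrier G)"

lemma derived_normal: "D \<lhd> G"
  by (rule derived_self_is_normal)

lemma derived_closed: "d \<in> D \<Longrightarrow> d \<in> carrier G"
  using derived_in_carrier[of "carrier G"] by auto

lemma derived_invariant: "\<alpha> ` D = D"
  using group_hom.derived_img[OF group_hom_\<alpha>, of "carrier G"] power_surj[of 1] by simp

lemma derived_times_power:
  assumes odd: "odd (order G)" and y: "y \<in> carrier G"
  obtains d and i :: int where "d \<in> D" "y = d \<otimes> x [^] i"
proof -
  interpret D: normal D G by (rule derived_normal)
  interpret Q: cyclic_transitive "G Mod D" "D #> x" "(`) \<alpha>"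
    by (rule quotient_cyclic_transitive) (simp_all add: derived_normal derived_invariant)
  have "order (G Mod D) * card D = order G"
    using lagrange[OF D.subgroup_axioms] by (simp add: order_def FactGroup_def)
  then have "odd (order (G Mod D))" using odd by (metis even_mult_iff)
  then have "generate (G Mod D) {D #> x} = carrier (G Mod D)"
    by (intro Q.abelian_odd_generated derived_quot_is_comm_group)
  then have "D #> y \<in> generate (G Mod D) {D #> x}"
    using y by (simp add: carrier_FactGroup)
  then obtain i :: int where "D #> y = D #> x [^] i"
    by (auto simp: Q.generate_pow D.FactGroup_int_pow)
  then have "y \<in> D #> x [^] i" using rcos_self[OF y D.subgroup_axioms] by simp
  then show thesis using that by (auto simp: r_coset_def)
qed

lemma derived_cyclic:
  assumes odd: "odd (order G)"
  obtains a where "a \<in> D" "D = generate G {a}"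
proof -
  have sub: "subgroup D G" by (rule derived_is_subgroup) simp
  obtain m where "cyclic_transitive (G\<lparr>carrier := D\<rparr>) (orb m) (\<alpha> ^^ m)"
    using subgroup_cyclic_transitive[OF sub] derived_invariant by auto
  then interpret S: cyclic_transitive "G\<lparr>carrier := D\<rparr>" "orb m" "\<alpha> ^^ m" .
  have "comm_group (G\<lparr>carrier := D\<rparr>)"
    by (rule S.group_comm_groupI) (simp add: derived_commute)
  moreover have "odd (order (G\<lparr>carrier := D\<rparr>))"
    using lagrange[OF sub] odd by (simp add: order_def) (metis even_mult_iff)
  ultimately have "generate (G\<lparr>carrier := D\<rparr>) {orb m} = D"
    using S.abelian_odd_generated by simp
  moreover have "orb m \<in> D" using S.x_closed by simp
  moreover from this have "generate (G\<lparr>carrier := D\<rparr>) {orb m} = generate G {orb m}"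
    by (intro generate_consistent sub) auto
  ultimately show thesis by (intro that[of "orb m"]) (simp_all only:)
qed

text \<open>
  As \<open>D\<close> is abelian, \<open>\<kappa>(z) = [x, z]\<close> is an endomorphism of \<open>D\<close>.  Modulo its image, \<open>x\<close> commutes with
  \<open>D\<close>; since \<open>G = D\<langle>x\<rangle>\<close>, the quotient of \<open>G\<close> by the image is abelian.  So the image is all of \<open>D\<close>, and
  by finiteness \<open>\<kappa>\<close> is injective.
\<close>

lemma derived_commuting_trivial:
  assumes odd: "odd (order G)" and z: "z \<in> D" and comm: "x \<otimes> z = z \<otimes> x"
  shows "z = \<one>"
proof -
  interpret D: normal D G by (rule derived_normal)
  note [simp] = derived_closed
  define \<kappa> where "\<kappa> z = x \<otimes> z \<otimes> inv x \<otimes> inv z" for z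
  have \<kappa>_closed: "\<kappa> z \<in> D" if "z \<in> D" for z
    using that unfolding \<kappa>_def
    by (intro D.m_closed D.inv_op_closed2 D.m_inv_closed x_closed)
  have \<kappa>_mult: "\<kappa> (z \<otimes> w) = \<kappa> z \<otimes> \<kappa> w" if "z \<in> D" "w \<in> D" for z w
  proof -
    have xz: "x \<otimes> z \<otimes> inv x \<in> D" "x \<otimes> w \<otimes> inv x \<in> D" using that by (simp_all add: D.inv_op_closed2)
    have "\<kappa> (z \<otimes> w) = (x \<otimes> z \<otimes> inv x) \<otimes> ((x \<otimes> w \<otimes> inv x) \<otimes> (inv w \<otimes> inv z))"
      using that by (simp add: \<kappa>_def m_assoc inv_mult_group inv_mult_cancel)
    also have "inv w \<otimes> inv z = inv z \<otimes> inv w"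
      using that derived_commute by (simp add: D.m_inv_closed)
    also have "(x \<otimes> w \<otimes> inv x) \<otimes> (inv z \<otimes> inv w) = inv z \<otimes> (x \<otimes> w \<otimes> inv x) \<otimes> inv w"
      using derived_commute[OF xz(2), of "inv z"] that by (simp add: D.m_inv_closed flip: m_assoc)
    finally show ?thesis using that by (simp add: \<kappa>_def m_assoc)
  qed
  have \<kappa>_one: "\<kappa> \<one> = \<one>" by (simp add: \<kappa>_def)
  have \<kappa>_hom: "\<kappa> \<in> hom (G\<lparr>carrier := D\<rparr>) G"
    by (rule homI) (auto simp: \<kappa>_mult \<kappa>_closed)
  define I where "I = \<kappa> ` D"
  have I_D: "I \<subseteq> D" using \<kappa>_closed by (auto simp: I_def)
  have "group_hom (G\<lparr>carrier := D\<rparr>) G \<kappa>"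
    by (intro group_hom.intro group_hom_axioms.intro is_group \<kappa>_hom
        subgroup.subgroup_is_group[OF D.subgroup_axioms])
  from group_hom.img_is_subgroup[OF this] have I: "subgroup I G" by (simp add: I_def)
  have "I \<lhd> G"
  proof (rule normal_invI[OF I])
    fix g h assume g: "g \<in> carrier G" and "h \<in> I"
    then obtain w where w: "w \<in> D" "h = \<kappa> w" by (auto simp: I_def)
    obtain d and i :: int where g': "d \<in> D" "g = d \<otimes> x [^] i" using derived_times_power[OF odd g] .
    interpret c: group_hom G G "\<lambda>z. x [^] i \<otimes> z \<otimes> inv (x [^] i)" by (rule conj_hom) simp
    have x_fixed: "x [^] i \<otimes> x \<otimes> inv (x [^] i) = x"
      unfolding commute_int_pow[OF x_closed x_closed refl, symmetric] by (simp add: m_assoc)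
    have cw: "x [^] i \<otimes> w \<otimes> inv (x [^] i) \<in> D" using w by (simp add: D.inv_op_closed2)
    have "x [^] i \<otimes> h \<otimes> inv (x [^] i) = \<kappa> (x [^] i \<otimes> w \<otimes> inv (x [^] i))"
      using w c.hom_mult[of "x \<otimes> w \<otimes> inv x" "inv w"] c.hom_mult[of "x \<otimes> w" "inv x"]
        c.hom_mult[of x w] x_fixed by (simp add: \<kappa>_def)
    then have k: "x [^] i \<otimes> h \<otimes> inv (x [^] i) \<in> I" using cw by (simp add: I_def)
    define u where "u = x [^] i \<otimes> h \<otimes> inv (x [^] i)"
    have "u \<in> D" using k I_D by (auto simp: u_def)
    have "g \<otimes> h \<otimes> inv g = d \<otimes> u \<otimes> inv d"
      using w g' \<kappa>_closed[OF w(1)] by (simp add: u_def m_assoc inv_mult_group)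
    also have "\<dots> = u"
      using derived_commute[OF g'(1) \<open>u \<in> D\<close>] g'(1) \<open>u \<in> D\<close> by (simp add: m_assoc)
    finally show "g \<otimes> h \<otimes> inv g \<in> I" using k by (simp add: u_def)
  qed
  then interpret I: normal I G .
  interpret Q: group "G Mod I" by (rule I.factorgroup_is_group)
  define S where "S = insert (I #> x) ((\<lambda>d. I #> d) ` D)"
  have S: "S \<subseteq> carrier (G Mod I)" by (auto simp: S_def carrier_FactGroup)
  have xd: "I #> (x \<otimes> d) = I #> (d \<otimes> x)" if "d \<in> D" for d
  proof -
    have "x \<otimes> d = \<kappa> d \<otimes> (d \<otimes> x)"
      using that by (simp add: \<kappa>_def m_assoc inv_mult_cancel)
    moreover have "\<kappa> d \<in> I" using that by (simp add: I_def)
    ultimately show ?thesis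
      using that I.rcos_const[OF is_group, of "\<kappa> d"] coset_mult_assoc[of I "\<kappa> d" "d \<otimes> x"] I.subset
      by (metis I.mem_carrier derived_closed m_closed x_closed)
  qed
  have comm_S: "s \<otimes>\<^bsub>G Mod I\<^esub> t = t \<otimes>\<^bsub>G Mod I\<^esub> s" if "s \<in> S" "t \<in> S" for s t
    using that xd derived_commute by (auto simp: S_def I.rcos_sum)
  have "carrier (G Mod I) \<subseteq> generate (G Mod I) S"
  proof
    fix A assume "A \<in> carrier (G Mod I)"
    then obtain y where y: "y \<in> carrier G" "A = I #> y" by (auto simp: carrier_FactGroup)
    obtain d and i :: int where "d \<in> D" "y = d \<otimes> x [^] i" using derived_times_power[OF odd y(1)] .
    then have "A = (I #> d) \<otimes>\<^bsub>G Mod I\<^esub> (I #> x) [^]\<^bsub>G Mod I\<^esub> i"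
      using y by (simp add: I.rcos_sum I.FactGroup_int_pow)
    also have "\<dots> \<in> generate (G Mod I) S"
    proof (rule generate.eng)
      show "I #> d \<in> generate (G Mod I) S" by (rule generate.incl) (use \<open>d \<in> D\<close> in \<open>auto simp: S_def\<close>)
      show "(I #> x) [^]\<^bsub>G Mod I\<^esub> i \<in> generate (G Mod I) S"
        by (intro Q.subgroup_int_pow_closed Q.generate_is_subgroup S generate.incl) (auto simp: S_def)
    qed
    finally show "A \<in> generate (G Mod I) S" .
  qed
  then have "comm_group (G Mod I)"
    using Q.generate_commute[OF S comm_S] by (intro Q.group_comm_groupI) (auto simp del: mult_FactGroup)
  then have "D \<subseteq> I" by (rule derived_minimal[OF I.normal_axioms])
  then have "\<kappa> ` D = D" using I_D by (auto simp: I_def)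
  then have "inj_on \<kappa> D"
    by (intro finite_surj_inj finite_subset[OF D.subset finite_carrier]) auto
  moreover have "\<kappa> z = \<kappa> \<one>" using z comm by (simp add: \<kappa>_one) (simp add: \<kappa>_def m_assoc)
  ultimately show ?thesis using z D.one_closed by (auto dest: inj_onD)
qed

lemma derived_int_powers:
  assumes odd: "odd (order G)" and "x [^] (i::int) \<in> D"
  shows "x [^] i = \<one>"
  using derived_commuting_trivial[OF odd assms(2)] commute_int_pow[of x x i] by simp


lemma pow_conj:
  assumes "y \<in> carrier G" "z \<in> carrier G" "y \<otimes> z \<otimes> inv y = z [^] (t::nat)"
  shows "y [^] (r::nat) \<otimes> z \<otimes> inv (y [^] r) = z [^] (t ^ r)"
proof (induction r)
  case (Suc r)
  interpret c: group_hom G G "\<lambda>z. y [^] r \<otimes> z \<otimes> inv (y [^] r)" by (rule conj_hom) (simp add: assms)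
  have "y [^] Suc r \<otimes> z \<otimes> inv (y [^] Suc r) = y [^] r \<otimes> (y \<otimes> z \<otimes> inv y) \<otimes> inv (y [^] r)"
    using assms(1,2) by (simp add: m_assoc inv_mult_group)
  also have "\<dots> = (y [^] r \<otimes> z \<otimes> inv (y [^] r)) [^] t"
    using c.hom_nat_pow[of z t] assms by simp
  also have "\<dots> = z [^] (t ^ Suc r)"
    using Suc assms(2) by (simp add: nat_pow_pow mult.commute)
  finally show ?case .
qed (use assms in simp)

text \<open>
  Conjugation by \<open>y\<close> acts on the cyclic group \<open>D\<close> as \<open>a \<mapsto> a\<^sup>t\<close>.  As \<open>y\<^sup>p\<close> lies in the abelian group
  \<open>D\<close>, \<open>t\<^sup>p \<equiv> 1\<close> modulo \<open>|D|\<close>, hence modulo \<open>p\<close>, and Fermat's little theorem gives \<open>t \<equiv> 1\<close> modulo \<open>p\<close>.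
\<close>

lemma conj_trivial_mod_powers:
  assumes odd: "odd (order G)" and p: "Factorial_Ring.prime (p::nat)" "p dvd card D"
    and y: "y \<in> carrier G" "y [^] p \<in> D" and d: "d \<in> D"
  shows "y \<otimes> d \<otimes> inv y \<otimes> inv d \<in> (\<lambda>z. z [^] p) ` D"
proof -
  interpret D: normal D G by (rule derived_normal)
  obtain a where a: "a \<in> D" "D = generate G {a}" using derived_cyclic[OF odd] .
  note [simp] = derived_closed[OF a(1)] derived_closed[OF d] y(1)
  have ord_a: "ord a = card D" using generate_pow_card[of a] a(2) by simp
  have pows: "\<exists>t::nat. w = a [^] t" if "w \<in> D" for w
    using that generate_pow_nat[of a] ord_ge_1[OF finite_carrier, of a]
    unfolding a(2) by auto
  obtain t where t: "y \<otimes> a \<otimes> inv y = a [^] (t::nat)"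
    using pows D.inv_op_closed2[OF y(1) a(1)] by blast
  have "a [^] (t ^ p) = y [^] p \<otimes> a \<otimes> inv (y [^] p)"
    using pow_conj[OF y(1) _ t, of p] by simp
  also have "\<dots> = a [^] (1::nat)"
    using derived_commute[OF y(2) a(1)] by (simp add: m_assoc)
  finally have "a [^] int (t ^ p) = a [^] int 1" by (simp only: int_pow_int)
  then have "int (ord a) dvd int 1 - int (t ^ p)" by (subst (asm) int_pow_eq) simp_all
  then have "[int 1 = int (t ^ p)] (mod int (ord a))" by (simp only: cong_iff_dvd_diff)
  then have "[t ^ p = 1] (mod ord a)" by (simp only: cong_int_iff cong_sym_eq)
  then have "[t ^ p = 1] (mod p)" using p(2) unfolding ord_a by (rule cong_dvd_modulus_nat)
  moreover have "[t ^ p = t] (mod p)"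
  proof (cases "p dvd t")
    case True
    then have "p dvd t ^ p" using p(1) by (meson dvd_power dvd_trans prime_gt_0_nat)
    then show ?thesis using True by (simp add: cong_def)
  next
    case False
    have "[t ^ (p - 1) * t = 1 * t] (mod p)"
      by (intro cong_mult fermat_theorem p False cong_refl)
    moreover have "t ^ (p - 1) * t = t ^ p" using p(1) by (simp add: power_eq_if prime_gt_0_nat)
    ultimately show ?thesis by simp
  qed
  ultimately have "[t = 1] (mod p)" by (metis cong_sym cong_trans)
  then have "t mod p = 1" using prime_gt_1_nat[OF p(1)] by (simp add: cong_def)
  then obtain s where s: "t = p * s + 1" by (metis mult_div_mod_eq)
  obtain j where j: "d = a [^] (j::nat)" using pows d by blast
  interpret c: group_hom G G "\<lambda>z. y \<otimes> z \<otimes> inv y" by (rule conj_hom) simp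
  have "y \<otimes> d \<otimes> inv y = (a [^] t) [^] j" unfolding j using c.hom_nat_pow[of a j] t by simp
  also have "\<dots> = a [^] (t * j)" by (rule nat_pow_pow) simp
  also have "t * j = s * j * p + j" by (simp add: s algebra_simps)
  also have "a [^] (s * j * p + j) = (a [^] (s * j)) [^] p \<otimes> d"
    by (simp add: nat_pow_pow nat_pow_mult j)
  finally have "y \<otimes> d \<otimes> inv y \<otimes> inv d = (a [^] (s * j)) [^] p"
    by (simp add: m_assoc)
  moreover have "a [^] (s * j) \<in> D"
    using subgroup_int_pow_closed[OF D.subgroup_axioms a(1), of "int (s * j)"] unfolding int_pow_int .
  ultimately show ?thesis by blast
qed


text \<open>
  Suppose that \<open>p\<close> divides both numbers.  Let \<open>L/D\<close> consist of the elements of \<open>G/D\<close> killed by \<open>p\<close>, and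
  let \<open>M = D\<^sup>p\<close>.  Both are preserved by \<open>\<alpha>\<close>, and \<open>L/M\<close> is elementary abelian: \<open>D/M\<close> is central
  in it, and \<open>L\<close> is \<open>D\<close> times those powers of \<open>x\<close> that \<open>p\<close> kills.  So \<open>L/M\<close> is generated by one element
  and \<open>|L| \<le> p |M| = |D|\<close>.  But \<open>L\<close> contains, besides \<open>D\<close>, the elements of order \<open>p\<close> in \<open>\<langle>x\<rangle>\<close>.
\<close>

lemma coprime_derived_ord:
  assumes odd: "odd (order G)"
  shows "coprime (card D) (ord x)"
proof (rule ccontr)
  assume "\<not> coprime (card D) (ord x)"
  then obtain p where p: "Factorial_Ring.prime p" "p dvd card D" "p dvd ord x"
    using prime_factor_nat[of "gcd (card D) (ord x)"] by (auto simp: coprime_iff_gcd_eq_1)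
  interpret D: normal D G by (rule derived_normal)
  have "p dvd order G" using p(3) ord_dvd_group_order[OF x_closed] dvd_trans by blast
  then have p_odd: "odd p" using odd dvd_trans by blast
  have p1: "p > 1" using p(1) by (rule prime_gt_1_nat)
  note D_closed [simp] = derived_closed

  define L where "L = {y \<in> carrier G. y [^] p \<in> D}"
  define M where "M = (\<lambda>z. z [^] p) ` D"
  have L_closed: "y \<in> carrier G" if "y \<in> L" for y using that by (simp add: L_def)
  have pow_D: "d [^] (n::nat) \<in> D" if "d \<in> D" for d n
    using subgroup_int_pow_closed[OF D.subgroup_axioms that, of "int n"] unfolding int_pow_int .
  have D_L: "D \<subseteq> L" using pow_D by (auto simp: L_def)
  have M_D: "M \<subseteq> D" using pow_D by (auto simp: M_def)
  have L: "subgroup L G"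
  proof -
    interpret Q: comm_group "G Mod D" by (rule derived_quot_is_comm_group)
    have mem: "y \<in> L \<longleftrightarrow> (D #> y) [^]\<^bsub>G Mod D\<^esub> p = \<one>\<^bsub>G Mod D\<^esub>" if "y \<in> carrier G" for y
      using that D.FactGroup_pow[OF that] coset_join1[OF _ _ D.subgroup_axioms, of "y [^] p"]
        D.rcos_const[OF is_group, of "y [^] p"] by (auto simp: L_def D.subset)
    have Q_mem: "D #> y \<in> carrier (G Mod D)" if "y \<in> carrier G" for y
      using that by (simp add: carrier_FactGroup)
    show ?thesis
    proof (rule subgroupI)
      fix y z assume yz: "y \<in> L" "z \<in> L"
      then have c: "y \<in> carrier G" "z \<in> carrier G" by (simp_all add: L_closed)
      have "D #> (y \<otimes> z) = (D #> y) \<otimes>\<^bsub>G Mod D\<^esub> (D #> z)" using c by (simp add: D.rcos_sum)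
      then show "y \<otimes> z \<in> L"
        using yz c mem Q.nat_pow_distrib[OF Q_mem Q_mem, of y z p] by (simp del: mult_FactGroup one_FactGroup)
    next
      fix y assume "y \<in> L"
      then show "inv y \<in> L" by (auto simp: L_def nat_pow_inv D.m_inv_closed)
    qed (use D_L D.one_closed in \<open>auto simp: L_def\<close>)
  qed
  have "\<alpha> ` L \<subseteq> L"
    using derived_invariant by (auto simp: L_def simp flip: \<alpha>_pow)
  with subgroup_cyclic_transitive[OF L] obtain m
    where "cyclic_transitive (G\<lparr>carrier := L\<rparr>) (orb m) (\<alpha> ^^ m)" by blast
  then interpret S: cyclic_transitive "G\<lparr>carrier := L\<rparr>" "orb m" "\<alpha> ^^ m" .
  let ?L = "G\<lparr>carrier := L\<rparr>"
  have pow_L: "y [^]\<^bsub>?L\<^esub> (n::nat) = y [^] n" for y n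
    by (induction n) simp_all
  have inv_L: "inv\<^bsub>?L\<^esub> y = inv y" if "y \<in> L" for y
    using m_inv_consistent[OF L that] .

  have M: "M \<lhd> ?L"
  proof (rule S.normal_invI)
    have "comm_group (G\<lparr>carrier := D\<rparr>)"
      by (rule group.group_comm_groupI[OF subgroup.subgroup_is_group[OF D.subgroup_axioms is_group]])
        (simp add: derived_commute)
    from comm_group.subgroup_powers[OF this, of p]
    have "subgroup M (G\<lparr>carrier := D\<rparr>)"
      by (simp add: M_def nat_pow_consistent[symmetric])
    then have "subgroup M G" by (rule incl_subgroup[OF D.subgroup_axioms])
    then show "subgroup M ?L" using M_D D_L by (intro subgroup_incl L) auto
    fix g h assume g: "g \<in> carrier ?L" and "h \<in> M"
    then obtain d where d: "d \<in> D" "h = d [^] p" by (auto simp: M_def)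
    have g': "g \<in> carrier G" using g L_closed by simp
    interpret c: group_hom G G "\<lambda>z. g \<otimes> z \<otimes> inv g" by (rule conj_hom[OF g'])
    have "g \<otimes> h \<otimes> inv g = (g \<otimes> d \<otimes> inv g) [^] p" using d c.hom_nat_pow by simp
    then show "g \<otimes>\<^bsub>?L\<^esub> h \<otimes>\<^bsub>?L\<^esub> inv\<^bsub>?L\<^esub> g \<in> M"
      using g d g' by (auto simp: inv_L M_def D.inv_op_closed2)
  qed
  interpret M: normal M ?L by (rule M)
  have "\<alpha> ` M \<subseteq> M"
  proof
    fix w assume "w \<in> \<alpha> ` M"
    then obtain d where d: "d \<in> D" "w = (\<alpha> d) [^] p" by (auto simp: M_def)
    then have "\<alpha> d \<in> D" using derived_invariant by blast
    with d show "w \<in> M" by (simp add: M_def)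
  qed
  then have "(\<alpha> ^^ m) ` M \<subseteq> M"
    using invariant_power_image[of M m] M_D D.subset by auto
  then interpret Q: cyclic_transitive "?L Mod M" "M #>\<^bsub>?L\<^esub> orb m" "(`) (\<alpha> ^^ m)"
    by (rule S.quotient_cyclic_transitive[OF M])
  have cos_mult: "M #>\<^bsub>?L\<^esub> (y \<otimes> z) = (M #>\<^bsub>?L\<^esub> y) \<otimes>\<^bsub>?L Mod M\<^esub> (M #>\<^bsub>?L\<^esub> z)" if "y \<in> L" "z \<in> L" for y z
    using that M.rcos_sum[of y z] by simp
  have cos_in: "M #>\<^bsub>?L\<^esub> y \<in> carrier (?L Mod M)" if "y \<in> L" for y
    using that by (auto simp: carrier_FactGroup)

  \<comment> \<open>The \<open>p\<close>-th power of the factor in \<open>\<langle>x\<rangle>\<close> lies in \<open>D \<inter> \<langle>x\<rangle>\<close>, which is trivial.\<close>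
  have split: "\<exists>d u i. y = d \<otimes> u \<and> d \<in> D \<and> u \<in> L \<and> u [^] p = \<one> \<and> u = x [^] (i::int)" if y: "y \<in> L" for y
  proof -
    obtain d and i :: int where di: "d \<in> D" "y = d \<otimes> x [^] i"
      using derived_times_power[OF odd L_closed[OF y]] .
    have "x [^] i = inv d \<otimes> y" using di by (simp add: inv_mult_cancel)
    also have "\<dots> \<in> L" using di y D_L by (intro subgroup.m_closed[OF L] subgroup.m_inv_closed[OF L]) auto
    finally have u: "x [^] i \<in> L" .
    then have "x [^] (i * int p) \<in> D" by (simp add: L_def int_pow_pow[symmetric] int_pow_int)
    then have "x [^] (i * int p) = \<one>" by (rule derived_int_powers[OF odd])
    then have "(x [^] i) [^] p = \<one>" by (simp add: int_pow_pow[symmetric] int_pow_int)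
    with di u show ?thesis by blast
  qed
  have comm_D: "(M #>\<^bsub>?L\<^esub> y) \<otimes>\<^bsub>?L Mod M\<^esub> (M #>\<^bsub>?L\<^esub> d) = (M #>\<^bsub>?L\<^esub> d) \<otimes>\<^bsub>?L Mod M\<^esub> (M #>\<^bsub>?L\<^esub> y)"
    if y: "y \<in> L" and d: "d \<in> D" for y d
  proof -
    define c where "c = y \<otimes> d \<otimes> inv y \<otimes> inv d"
    have "c \<in> M" unfolding c_def M_def
      using conj_trivial_mod_powers[OF odd p(1,2) _ _ d, of y] y by (simp add: L_def)
    moreover have "c \<in> L" using \<open>c \<in> M\<close> M_D D_L by auto
    moreover have "d \<in> L" using d D_L by auto
    moreover have "y \<otimes> d = c \<otimes> (d \<otimes> y)"
      using y d by (simp add: c_def m_assoc inv_mult_cancel L_closed)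
    moreover have "M #>\<^bsub>?L\<^esub> (c \<otimes> (d \<otimes> y)) = (M #>\<^bsub>?L\<^esub> c) \<otimes>\<^bsub>?L Mod M\<^esub> (M #>\<^bsub>?L\<^esub> (d \<otimes> y))"
      using \<open>c \<in> L\<close> \<open>d \<in> L\<close> y by (intro cos_mult subgroup.m_closed[OF L])
    moreover have "M #>\<^bsub>?L\<^esub> c = \<one>\<^bsub>?L Mod M\<^esub>"
      using M.rcos_const[OF S.is_group \<open>c \<in> M\<close>] by simp
    ultimately show ?thesis
      using y cos_mult[of y d] cos_mult[of d y] Q.l_one[OF cos_in, of "d \<otimes> y"] subgroup.m_closed[OF L, of d y]
      by (simp del: mult_FactGroup one_FactGroup)
  qed
  have comm: "comm_group (?L Mod M)"
  proof (rule Q.group_comm_groupI)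
    fix A B assume "A \<in> carrier (?L Mod M)" "B \<in> carrier (?L Mod M)"
    then obtain y z where yz: "y \<in> L" "z \<in> L" "A = M #>\<^bsub>?L\<^esub> y" "B = M #>\<^bsub>?L\<^esub> z"
      by (auto simp: carrier_FactGroup)
    obtain d u i where d: "y = d \<otimes> u" "d \<in> D" "u \<in> L" "u = x [^] (i::int)" using split[OF yz(1)] by blast
    obtain e v j where e: "z = e \<otimes> v" "e \<in> D" "v \<in> L" "v = x [^] (j::int)" using split[OF yz(2)] by blast
    have L': "d \<in> L" "e \<in> L" using d e D_L by auto
    have "u \<otimes> v = v \<otimes> u" unfolding d e by (simp add: int_pow_mult[symmetric] add.commute)
    define d' u' e' v' where "d' = M #>\<^bsub>?L\<^esub> d" and "u' = M #>\<^bsub>?L\<^esub> u" and "e' = M #>\<^bsub>?L\<^esub> e" and "v' = M #>\<^bsub>?L\<^esub> v"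
    note defs = d'_def u'_def e'_def v'_def
    have c: "d' \<in> carrier (?L Mod M)" "u' \<in> carrier (?L Mod M)" "e' \<in> carrier (?L Mod M)" "v' \<in> carrier (?L Mod M)"
      unfolding defs by (intro cos_in L' d(3) e(3))+
    have AB: "A = d' \<otimes>\<^bsub>?L Mod M\<^esub> u'" "B = e' \<otimes>\<^bsub>?L Mod M\<^esub> v'"
      unfolding defs yz d(1) e(1) using L' d(3) e(3) by (simp_all only: cos_mult)
    have cm: "u' \<otimes>\<^bsub>?L Mod M\<^esub> e' = e' \<otimes>\<^bsub>?L Mod M\<^esub> u'" "v' \<otimes>\<^bsub>?L Mod M\<^esub> d' = d' \<otimes>\<^bsub>?L Mod M\<^esub> v'"
      "d' \<otimes>\<^bsub>?L Mod M\<^esub> e' = e' \<otimes>\<^bsub>?L Mod M\<^esub> d'"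
      unfolding defs using comm_D L' d e by auto
    have cu: "u' \<otimes>\<^bsub>?L Mod M\<^esub> v' = v' \<otimes>\<^bsub>?L Mod M\<^esub> u'"
      unfolding defs using cos_mult[OF d(3) e(3)] cos_mult[OF e(3) d(3)] \<open>u \<otimes> v = v \<otimes> u\<close> by simp
    have "A \<otimes>\<^bsub>?L Mod M\<^esub> B = d' \<otimes>\<^bsub>?L Mod M\<^esub> (u' \<otimes>\<^bsub>?L Mod M\<^esub> e') \<otimes>\<^bsub>?L Mod M\<^esub> v'"
      using c by (simp add: AB Q.m_assoc del: mult_FactGroup)
    also have "\<dots> = (d' \<otimes>\<^bsub>?L Mod M\<^esub> e') \<otimes>\<^bsub>?L Mod M\<^esub> (u' \<otimes>\<^bsub>?L Mod M\<^esub> v')"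
      using c by (simp add: cm(1) Q.m_assoc del: mult_FactGroup)
    also have "\<dots> = e' \<otimes>\<^bsub>?L Mod M\<^esub> (d' \<otimes>\<^bsub>?L Mod M\<^esub> v') \<otimes>\<^bsub>?L Mod M\<^esub> u'"
      using c unfolding cm(3) cu by (simp add: Q.m_assoc del: mult_FactGroup)
    also have "\<dots> = B \<otimes>\<^bsub>?L Mod M\<^esub> A"
      using c by (simp add: cm(2)[symmetric] AB Q.m_assoc del: mult_FactGroup)
    finally show "A \<otimes>\<^bsub>?L Mod M\<^esub> B = B \<otimes>\<^bsub>?L Mod M\<^esub> A" .
  qed
  interpret QC: comm_group "?L Mod M" by (rule comm)
  have exponent: "A [^]\<^bsub>?L Mod M\<^esub> p = \<one>\<^bsub>?L Mod M\<^esub>" if "A \<in> carrier (?L Mod M)" for A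
  proof -
    obtain y where y: "y \<in> L" "A = M #>\<^bsub>?L\<^esub> y" using \<open>A \<in> carrier _\<close> by (auto simp: carrier_FactGroup)
    obtain d u where d: "y = d \<otimes> u" "d \<in> D" "u \<in> L" "u [^] p = \<one>" using split[OF y(1)] by blast
    have dL: "d \<in> L" using d D_L by auto
    have "A [^]\<^bsub>?L Mod M\<^esub> p = (M #>\<^bsub>?L\<^esub> d) [^]\<^bsub>?L Mod M\<^esub> p \<otimes>\<^bsub>?L Mod M\<^esub> (M #>\<^bsub>?L\<^esub> u) [^]\<^bsub>?L Mod M\<^esub> p"
      unfolding y(2) d(1) cos_mult[OF dL d(3)] by (rule QC.nat_pow_distrib) (use dL d cos_in in auto)
    also have "(M #>\<^bsub>?L\<^esub> d) [^]\<^bsub>?L Mod M\<^esub> p = \<one>\<^bsub>?L Mod M\<^esub>"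
      using M.FactGroup_pow[of d p] M.rcos_const[OF S.is_group, of "d [^] p"] d dL by (simp add: pow_L M_def)
    also have "(M #>\<^bsub>?L\<^esub> u) [^]\<^bsub>?L Mod M\<^esub> p = \<one>\<^bsub>?L Mod M\<^esub>"
      using M.FactGroup_pow[of u p] M.rcos_const[OF S.is_group M.one_closed] d by (simp add: pow_L)
    finally show ?thesis by (simp del: mult_FactGroup one_FactGroup)
  qed
  have "card (carrier (?L Mod M)) \<le> p"
  proof -
    have g: "generate (?L Mod M) {M #>\<^bsub>?L\<^esub> orb m} = carrier (?L Mod M)"
      by (rule Q.elementary_abelian_generated[OF comm p(1) p_odd exponent])
    have "Q.ord (M #>\<^bsub>?L\<^esub> orb m) dvd p"
      using exponent[OF Q.x_closed] Q.pow_eq_id[OF Q.x_closed] by simp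
    then have "Q.ord (M #>\<^bsub>?L\<^esub> orb m) \<le> p" using p1 by (intro dvd_imp_le) simp_all
    moreover have "Q.ord (M #>\<^bsub>?L\<^esub> orb m) = card (generate (?L Mod M) {M #>\<^bsub>?L\<^esub> orb m})"
      by (rule Q.generate_pow_card) (rule Q.x_closed)
    ultimately show ?thesis by (simp only: g)
  qed
  then have "card (rcosets\<^bsub>?L\<^esub> M) * card M \<le> p * card M"
    by (intro mult_le_mono1) (simp add: FactGroup_def)
  then have "card L \<le> p * card M"
    using S.lagrange[OF M.subgroup_axioms] by (simp add: order_def)
  moreover have "p * card M = card D"
  proof -
    obtain a where a: "a \<in> D" "D = generate G {a}" using derived_cyclic[OF odd] .
    have ac: "a \<in> carrier G" using a by simp
    have ord_a: "ord a = card D" using generate_pow_card[OF ac] a(2) by simp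
    have "generate G {a [^] p} \<subseteq> M"
    proof
      fix w assume "w \<in> generate G {a [^] p}"
      then obtain k :: int where "w = (a [^] p) [^] k" using ac by (auto simp: generate_pow)
      also have "\<dots> = (a [^] k) [^] p"
        using ac by (simp add: int_pow_int[symmetric] int_pow_pow mult.commute)
      finally show "w \<in> M"
        using subgroup_int_pow_closed[OF D.subgroup_axioms a(1), of k] by (auto simp: M_def)
    qed
    moreover have "M \<subseteq> generate G {a [^] p}"
    proof
      fix w assume "w \<in> M"
      then obtain k :: int where "w = (a [^] k) [^] p"
        using ac unfolding M_def a(2) by (auto simp: generate_pow)
      also have "\<dots> = (a [^] p) [^] k"
        using ac by (simp add: int_pow_int[symmetric] int_pow_pow mult.commute)
      finally show "w \<in> generate G {a [^] p}" using ac by (auto simp: generate_pow)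
    qed
    ultimately have "card M = ord (a [^] p)" using generate_pow_card[of "a [^] p"] ac by simp
    also have "\<dots> = card D div p" using ord_pow[OF ac, of p] p(2) p1 ord_a by simp
    finally show ?thesis using p(2) by simp
  qed
  moreover have "card D < card L"
  proof (rule psubset_card_mono)
    show "finite L" using finite_carrier by (simp add: L_def)
    let ?u = "x [^] (ord x div p)"
    have "?u [^] p = \<one>" using p(3) by (simp add: nat_pow_pow)
    then have "?u \<in> L" by (simp add: L_def D.one_closed)
    moreover have "?u \<notin> D"
    proof
      assume "?u \<in> D"
      then have "?u = \<one>" using derived_int_powers[OF odd, of "int (ord x div p)"] by (simp add: int_pow_int)
      then have "ord x dvd ord x div p" by (simp add: pow_eq_id)
      moreover have ord_pos: "ord x > 0" using ord_ge_1[OF finite_carrier x_closed] by simp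
      moreover from this have "ord x div p > 0" using p(3) p1 by (simp add: div_greater_zero_iff dvd_imp_le)
      moreover have "ord x div p < ord x" using ord_pos p1 by (rule div_less_dividend[rotated])
      ultimately show False by (auto dest!: dvd_imp_le)
    qed
    ultimately show "D \<subset> L" using D_L by auto
  qed
  ultimately show False by simp
qed

theorem coprime_metacyclic:
  assumes odd: "odd (order G)"
  obtains a b where "a \<in> carrier G" "b \<in> carrier G" "generate G {a} \<lhd> G"
    "generate G {a} \<inter> generate G {b} = {\<one>}" "ord a * ord b = order G" "coprime (ord a) (ord b)"
proof -
  interpret D: normal D G by (rule derived_normal)
  obtain a where a: "a \<in> D" "D = generate G {a}" using derived_cyclic[OF odd] .
  have ac: "a \<in> carrier G" using a derived_closed by blast
  have ord_a: "ord a = card D" using generate_pow_card[OF ac] a(2) by simp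
  let ?B = "generate G {x}"
  have B: "subgroup ?B G" by (rule generate_is_subgroup) simp
  have int: "D \<inter> ?B = {\<one>}"
  proof -
    have "w = \<one>" if w: "w \<in> D" "w \<in> ?B" for w
    proof -
      obtain i :: int where "w = x [^] i" using w(2) generate_pow[OF x_closed] by auto
      then show ?thesis using derived_int_powers[OF odd] w by simp
    qed
    then show ?thesis using D.one_closed subgroup.one_closed[OF B] by blast
  qed
  have "bij_betw (\<lambda>(d, y). d \<otimes> y) (D \<times> ?B) (carrier G)"
    unfolding bij_betw_def
  proof
    show "inj_on (\<lambda>(d, y). d \<otimes> y) (D \<times> ?B)"
    proof (rule inj_onI, clarify)
      fix d y d' y' assume m: "d \<in> D" "y \<in> ?B" "d' \<in> D" "y' \<in> ?B" and eq: "d \<otimes> y = d' \<otimes> y'"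
      have c: "d \<in> carrier G" "d' \<in> carrier G" "y \<in> carrier G" "y' \<in> carrier G"
        using m derived_closed subgroup.mem_carrier[OF B] by auto
      have e: "inv d' \<otimes> d = y' \<otimes> inv y"
        using c eq by (metis inv_closed inv_solve_left inv_solve_right m_assoc m_closed)
      have "inv d' \<otimes> d \<in> D" using m by (simp add: D.m_closed D.m_inv_closed)
      moreover have "y' \<otimes> inv y \<in> ?B" using m B by (simp add: subgroup.m_closed subgroup.m_inv_closed)
      ultimately have one: "inv d' \<otimes> d = \<one>" using int e by auto
      then have "d = d'" using c by (metis inv_equality inv_inv inv_closed)
      with eq c show "d = d' \<and> y = y'" by simp
    qed
    show "(\<lambda>(d, y). d \<otimes> y) ` (D \<times> ?B) = carrier G"
    proof
      show "(\<lambda>(d, y). d \<otimes> y) ` (D \<times> ?B) \<subseteq> carrier G"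
        using derived_closed subgroup.mem_carrier[OF B] by auto
      show "carrier G \<subseteq> (\<lambda>(d, y). d \<otimes> y) ` (D \<times> ?B)"
      proof
        fix y assume "y \<in> carrier G"
        then obtain d and i :: int where "d \<in> D" "y = d \<otimes> x [^] i" using derived_times_power[OF odd] by blast
        then show "y \<in> (\<lambda>(d, y). d \<otimes> y) ` (D \<times> ?B)"
          by (force simp: generate_pow)
      qed
    qed
  qed
  from bij_betw_same_card[OF this] have "ord a * ord x = order G"
    using generate_pow_card[OF x_closed] by (simp add: card_cartesian_product ord_a order_def)
  then show thesis
    using that[of a x] ac int coprime_derived_ord[OF odd] derived_normal a(2) ord_a by simp
qed

end

section \<open>Internal semidirect products\<close>

text \<open>
  The factors are given as embeddings of arbitrary groups \<open>A\<close> and \<open>B\<close>, so that the same lemma serves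
  for a factor \<open>\<int>\<^sub>k\<close> and for a factor that is itself an external semidirect product.
\<close>

lemma internal_semidirect_product:
  assumes G: "group G" "group A" "group B" and fin: "finite (carrier G)"
    and h: "h \<in> hom A G" "inj_on h (carrier A)" and q: "q \<in> hom B G" "inj_on q (carrier B)"
    and normal: "h ` carrier A \<lhd> G" and int: "h ` carrier A \<inter> q ` carrier B \<subseteq> {\<one>\<^bsub>G\<^esub>}"
    and order: "order A * order B = order G"
  obtains \<phi> where "\<phi> \<in> hom B (AutoGroup A)" "G \<cong> semidirect_product A \<phi> B"
proof -
  interpret G: group G by fact
  interpret A: group A by fact
  interpret B: group B by fact
  interpret h: group_hom A G h by (intro group_hom.intro group_hom_axioms.intro h G)
  interpret q: group_hom B G q by (intro group_hom.intro group_hom_axioms.intro q G)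
  interpret nrm: normal "h ` carrier A" G by fact
  define \<phi> where "\<phi> b = (\<lambda>a\<in>carrier A. inv_into (carrier A) h (q b \<otimes>\<^bsub>G\<^esub> h a \<otimes>\<^bsub>G\<^esub> inv\<^bsub>G\<^esub> q b))" for b
  have conj_mem: "q b \<otimes>\<^bsub>G\<^esub> h a \<otimes>\<^bsub>G\<^esub> inv\<^bsub>G\<^esub> q b \<in> h ` carrier A"
    if "b \<in> carrier B" "a \<in> carrier A" for a b
    using that by (intro nrm.inv_op_closed2) auto
  have \<phi>_closed [simp]: "\<phi> b a \<in> carrier A" if "b \<in> carrier B" "a \<in> carrier A" for a b
    using that conj_mem by (simp add: \<phi>_def inv_into_into)
  have h_\<phi>: "h (\<phi> b a) = q b \<otimes>\<^bsub>G\<^esub> h a \<otimes>\<^bsub>G\<^esub> inv\<^bsub>G\<^esub> q b" if "b \<in> carrier B" "a \<in> carrier A" for a b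
    using that conj_mem by (simp add: \<phi>_def f_inv_into_f)
  have h_eq: "a = a'" if "h a = h a'" "a \<in> carrier A" "a' \<in> carrier A" for a a'
    using that h(2) by (auto dest: inj_onD)
  have comp: "\<phi> b (\<phi> b' a) = \<phi> (b \<otimes>\<^bsub>B\<^esub> b') a" if "b \<in> carrier B" "b' \<in> carrier B" "a \<in> carrier A" for a b b'
    by (rule h_eq) (use that in \<open>simp_all add: h_\<phi> G.m_assoc G.inv_mult_group\<close>)
  have one: "\<phi> \<one>\<^bsub>B\<^esub> a = a" if "a \<in> carrier A" for a
    by (rule h_eq) (use that in \<open>simp_all add: h_\<phi>\<close>)
  have cancel: "inv\<^bsub>G\<^esub> y \<otimes>\<^bsub>G\<^esub> (y \<otimes>\<^bsub>G\<^esub> z) = z" if "y \<in> carrier G" "z \<in> carrier G" for y z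
    using that by (simp flip: G.m_assoc)
  have \<phi>_auto: "\<phi> b \<in> auto A" if b: "b \<in> carrier B" for b
  proof -
    have "\<phi> b \<in> hom A A"
    proof (rule homI)
      fix a a' assume "a \<in> carrier A" "a' \<in> carrier A"
      then show "\<phi> b (a \<otimes>\<^bsub>A\<^esub> a') = \<phi> b a \<otimes>\<^bsub>A\<^esub> \<phi> b a'"
        by (intro h_eq) (use b in \<open>simp_all add: h_\<phi> G.m_assoc cancel\<close>)
    qed (use b in simp)
    moreover have "bij_betw (\<phi> b) (carrier A) (carrier A)"
      by (rule bij_betwI[where g = "\<phi> (inv\<^bsub>B\<^esub> b)"]) (use b in \<open>auto simp: comp one\<close>)
    ultimately show ?thesis by (simp add: auto_def Bij_def \<phi>_def)
  qed
  have \<phi>: "\<phi> \<in> hom B (AutoGroup A)"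
  proof (rule homI)
    fix b b' assume b: "b \<in> carrier B" "b' \<in> carrier B"
    then have "\<phi> b \<in> Bij (carrier A)" "\<phi> b' \<in> Bij (carrier A)" using \<phi>_auto by (auto simp: auto_def)
    moreover have "\<phi> (b \<otimes>\<^bsub>B\<^esub> b') = compose (carrier A) (\<phi> b) (\<phi> b')"
    proof (rule extensionalityI[where A = "carrier A"])
      show "\<phi> (b \<otimes>\<^bsub>B\<^esub> b') \<in> extensional (carrier A)" by (simp add: \<phi>_def)
    qed (use b comp in \<open>auto simp: compose_def\<close>)
    ultimately show "\<phi> (b \<otimes>\<^bsub>B\<^esub> b') = \<phi> b \<otimes>\<^bsub>AutoGroup A\<^esub> \<phi> b'"
      by (simp add: AutoGroup_def BijGroup_def)
  qed (simp add: AutoGroup_def \<phi>_auto)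
  let ?P = "semidirect_product A \<phi> B"
  let ?f = "\<lambda>(a, b). h a \<otimes>\<^bsub>G\<^esub> q b"
  have inj: "inj_on ?f (carrier A \<times> carrier B)"
  proof (rule inj_onI, clarify)
    fix a b a' b'
    assume m: "a \<in> carrier A" "b \<in> carrier B" "a' \<in> carrier A" "b' \<in> carrier B"
      and eq: "h a \<otimes>\<^bsub>G\<^esub> q b = h a' \<otimes>\<^bsub>G\<^esub> q b'"
    have "h (inv\<^bsub>A\<^esub> a' \<otimes>\<^bsub>A\<^esub> a) = inv\<^bsub>G\<^esub> h a' \<otimes>\<^bsub>G\<^esub> (h a \<otimes>\<^bsub>G\<^esub> q b) \<otimes>\<^bsub>G\<^esub> inv\<^bsub>G\<^esub> q b"
      using m by (simp add: G.m_assoc)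
    also have "\<dots> = q (b' \<otimes>\<^bsub>B\<^esub> inv\<^bsub>B\<^esub> b)"
      unfolding eq using m by (simp add: cancel flip: G.m_assoc)
    finally have e: "h (inv\<^bsub>A\<^esub> a' \<otimes>\<^bsub>A\<^esub> a) = q (b' \<otimes>\<^bsub>B\<^esub> inv\<^bsub>B\<^esub> b)" .
    have "inv\<^bsub>A\<^esub> a' \<otimes>\<^bsub>A\<^esub> a \<in> carrier A" "b' \<otimes>\<^bsub>B\<^esub> inv\<^bsub>B\<^esub> b \<in> carrier B" using m by auto
    then have "h (inv\<^bsub>A\<^esub> a' \<otimes>\<^bsub>A\<^esub> a) \<in> h ` carrier A \<inter> q ` carrier B"
      using e by (metis IntI imageI)
    then have "h (inv\<^bsub>A\<^esub> a' \<otimes>\<^bsub>A\<^esub> a) = \<one>\<^bsub>G\<^esub>" using int by blast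
    then have "inv\<^bsub>A\<^esub> a' \<otimes>\<^bsub>A\<^esub> a = \<one>\<^bsub>A\<^esub>" using m by (intro h_eq) simp_all
    then have "inv\<^bsub>A\<^esub> a = inv\<^bsub>A\<^esub> a'" using m by (intro A.inv_equality) simp_all
    then have "inv\<^bsub>A\<^esub> (inv\<^bsub>A\<^esub> a) = inv\<^bsub>A\<^esub> (inv\<^bsub>A\<^esub> a')" by (rule arg_cong)
    then have "a = a'" using m by simp
    moreover from this have "q b = q b'" using eq m by simp
    then have "b = b'" using q(2) m by (auto dest: inj_onD)
    ultimately show "a = a' \<and> b = b'" by simp
  qed
  have sub: "?f ` (carrier A \<times> carrier B) \<subseteq> carrier G" by auto
  have "card (?f ` (carrier A \<times> carrier B)) = card (carrier G)"
    using card_image[OF inj] order by (simp add: order_def card_cartesian_product)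
  then have "?f ` (carrier A \<times> carrier B) = carrier G"
    using card_subset_eq[OF fin sub] by simp
  moreover have "?f \<in> hom ?P G"
    by (rule homI) (auto simp: h_\<phi> G.m_assoc cancel)
  ultimately have "?f \<in> iso ?P G"
    using inj by (simp add: iso_def bij_betw_def)
  then have "?P \<cong> G" by (auto simp: is_iso_def)
  then have "G \<cong> ?P"
    by (rule group.iso_sym[OF group_semidirect_product[OF G(2,3) \<phi>]])
  with \<phi> show thesis by (rule that)
qed

lemma order_integer_mod_group: "k > 0 \<Longrightarrow> order (integer_mod_group k) = k"
  by (simp add: order_def carrier_integer_mod_group)

lemma (in group) integer_mod_group_embedding:
  assumes a: "a \<in> carrier G" and k: "ord a = k" "k > 0"
  shows "([^]) a \<in> hom (integer_mod_group k) G"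
    and "inj_on (([^]) a) (carrier (integer_mod_group k))"
    and "([^]) a ` carrier (integer_mod_group k) = generate G {a}"
proof -
  have mod: "a [^] (i mod int k) = a [^] i" for i :: int
    using a k by (simp add: int_pow_eq mod_eq_dvd_iff[symmetric] dvd_diff_commute) 
  show "([^]) a \<in> hom (integer_mod_group k) G"
    by (rule homI) (use a in \<open>simp_all add: mod int_pow_mult\<close>)
  show "inj_on (([^]) a) (carrier (integer_mod_group k))"
  proof (rule inj_onI)
    fix i j assume ij: "i \<in> carrier (integer_mod_group k)" "j \<in> carrier (integer_mod_group k)" "a [^] i = a [^] j"
    then have "int k dvd j - i" using a k by (simp add: int_pow_eq)
    then have "j mod int k = i mod int k" by (simp add: mod_eq_dvd_iff)
    then show "i = j" using ij k by (simp add: carrier_integer_mod_group)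
  qed
  show "([^]) a ` carrier (integer_mod_group k) = generate G {a}"
  proof
    show "generate G {a} \<subseteq> ([^]) a ` carrier (integer_mod_group k)"
    proof
      fix y assume "y \<in> generate G {a}"
      then obtain i :: int where "y = a [^] i" using generate_pow[OF a] by auto
      then have "y = a [^] (i mod int k)" by (simp add: mod)
      then show "y \<in> ([^]) a ` carrier (integer_mod_group k)"
        using k by (auto simp: carrier_integer_mod_group)
    qed
  qed (use generate_pow[OF a] in auto)
qed

section \<open>The subgroup of index two\<close>

text \<open>
  Composing with the transposition of \<open>x\<close> and \<open>p x\<close> changes the sign and leaves an involution
  without fixed points on the remaining elements.
\<close>

lemma sign_fixpoint_free_involution:
  assumes "finite A" "p permutes A" "\<And>x. x \<in> A \<Longrightarrow> p x \<noteq> x" "\<And>x. x \<in> A \<Longrightarrow> p (p x) = x"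
  shows "sign p = (-1) ^ (card A div 2)"
  using assms
proof (induction A arbitrary: p rule: finite_psubset_induct)
  case (psubset A)
  show ?case
  proof (cases "A = {}")
    case True
    then show ?thesis using psubset.prems by simp
  next
    case False
    then obtain x where x: "x \<in> A" by blast
    have px: "p x \<in> A" "p x \<noteq> x" "p (p x) = x"
      using x psubset.prems by (auto simp: permutes_in_image)
    define A' where "A' = A - {x, p x}"
    define p' where "p' = Transposition.transpose x (p x) \<circ> p"
    have inj: "p y = p z \<longleftrightarrow> y = z" for y z
      using permutes_inj[OF psubset.prems(1)] by (auto dest: injD)
    have p'_eq: "p' y = p y" if "y \<in> A'" for y
      using that px inj[of y x] inj[of y "p x"] by (auto simp: p'_def A'_def transpose_def)
    have "p' permutes A"
      unfolding p'_def by (intro permutes_compose psubset.prems permutes_swap_id x px)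
    then have p': "p' permutes A'"
      by (rule permutes_superset) (auto simp: A'_def p'_def px)
    have "sign p' = (-1) ^ (card A' div 2)"
    proof (rule psubset.IH)
      show "A' \<subset> A" using x by (auto simp: A'_def)
      fix y assume y: "y \<in> A'"
      then have "p' y \<in> A'" using p' by (simp add: permutes_in_image)
      then show "p' (p' y) = y" using y psubset.prems by (auto simp: p'_eq A'_def)
      show "p' y \<noteq> y" using y psubset.prems by (auto simp: p'_eq A'_def)
    qed (rule p')
    moreover have "sign p' = - sign p"
      unfolding p'_def using px psubset.hyps psubset.prems
      by (subst sign_compose) (auto simp: sign_swap_id intro: permutes_imp_permutation permutation_swap_id)
    moreover have "card A = card A' + 2"
    proof -
      have "card A' = card A - card {x, p x}"
        unfolding A'_def using x px by (intro card_Diff_subset) auto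
      moreover have "card {x, p x} \<le> card A" using x px psubset.hyps by (intro card_mono) auto
      ultimately show ?thesis using px by simp
    qed
    ultimately show ?thesis by simp
  qed
qed

text \<open>
  The character \<open>\<epsilon>\<close> is the sign of left multiplication.  Left multiplication by an involution \<open>t\<close> has
  no fixed points, so \<open>\<epsilon> t = (-1)\<^sup>n = -1\<close> and the kernel has index 2.  Having odd order \<open>n\<close>, the
  kernel is the set of solutions of \<open>y\<^sup>n = 1\<close>, a description that makes its invariance under
  automorphisms evident.
\<close>

lemma (in group) regular_sign_character:
  assumes fin: "finite (carrier G)" and n: "order G = 2 * n" "odd n"
  obtains t and \<epsilon> :: "'a \<Rightarrow> int" where
    "t \<in> carrier G" "ord t = 2" "\<epsilon> t = -1"
    "\<And>y z. y \<in> carrier G \<Longrightarrow> z \<in> carrier G \<Longrightarrow> \<epsilon> (y \<otimes> z) = \<epsilon> y * \<epsilon> z"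
    "\<And>y. y \<in> carrier G \<Longrightarrow> \<epsilon> y = 1 \<longleftrightarrow> y [^] n = \<one>"
    "\<And>y. y \<in> carrier G \<Longrightarrow> \<epsilon> y = 1 \<or> \<epsilon> y = -1"
    "card {y \<in> carrier G. y [^] n = \<one>} = n"
proof -
  obtain T where T: "subgroup T G" "card T = 2"
    using sylow_thm[of 2 G 1 n] fin n is_group by auto
  obtain t where t: "t \<in> T" "t \<noteq> \<one>"
  proof -
    have "T \<noteq> {\<one>}" using T(2) by auto
    then show thesis using that subgroup.one_closed[OF T(1)] by blast
  qed
  have tc [simp]: "t \<in> carrier G" by (rule subgroup.mem_carrier[OF T(1) t(1)])
  have "t [^] (2::nat) = \<one>"
    using group.pow_order_eq_1[OF subgroup.subgroup_is_group[OF T(1) is_group], of t] t(1) T(2)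
    by (simp add: order_def nat_pow_consistent[symmetric])
  then have ord_t: "ord t = 2" by (rule ord_eq_prime[OF tc _ t(2) two_is_prime_nat])
  then have tt: "t \<otimes> (t \<otimes> z) = z" if "z \<in> carrier G" for z
    using that pow_ord_eq_1[OF tc] by (simp add: numeral_2_eq_2 flip: m_assoc)
  define \<epsilon> where "\<epsilon> y = sign_on (carrier G) (\<lambda>z. y \<otimes> z)" for y
  have bij: "bij_betw (\<lambda>z. y \<otimes> z) (carrier G) (carrier G)" if "y \<in> carrier G" for y
    by (rule bij_betwI[where g = "\<lambda>z. inv y \<otimes> z"]) (use that in \<open>auto simp flip: m_assoc\<close>)
  have mult: "\<epsilon> (y \<otimes> z) = \<epsilon> y * \<epsilon> z" if "y \<in> carrier G" "z \<in> carrier G" for y z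
  proof -
    have "\<epsilon> (y \<otimes> z) = sign_on (carrier G) ((\<lambda>z. y \<otimes> z) \<circ> (\<lambda>w. z \<otimes> w))"
      unfolding \<epsilon>_def by (rule sign_on_cong) (use that in \<open>auto simp: m_assoc\<close>)
    also have "\<dots> = \<epsilon> y * \<epsilon> z"
      unfolding \<epsilon>_def by (rule sign_on_compose) (use that bij fin in auto)
    finally show ?thesis .
  qed
  have pm: "\<epsilon> y = 1 \<or> \<epsilon> y = -1" for y
    unfolding \<epsilon>_def sign_on_def by (meson sign_cases)
  have pm': "\<epsilon> y = -1" if "\<epsilon> y \<noteq> 1" for y
    using pm[of y] that by simp
  have \<epsilon>_t: "\<epsilon> t = -1"
  proof -
    have "\<epsilon> t = (-1) ^ (card (carrier G) div 2)"
      unfolding \<epsilon>_def sign_on_def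
    proof (rule sign_fixpoint_free_involution[OF fin])
      show "restrict_id ((\<otimes>) t) (carrier G) permutes carrier G"
        by (rule permutes_restrict_id[OF bij[OF tc]])
    qed (use t in \<open>auto simp: tt\<close>)
    then show ?thesis using n by (simp add: order_def)
  qed
  have one: "\<epsilon> \<one> = 1" using mult[of \<one> \<one>] pm[of \<one>] by auto
  have pow: "\<epsilon> (y [^] (i::nat)) = \<epsilon> y ^ i" if "y \<in> carrier G" for y i
    using that by (induction i) (simp_all add: one mult)
  define K where "K = {y \<in> carrier G. \<epsilon> y = 1}"
  have K: "subgroup K G"
  proof (rule subgroupI)
    fix y assume y: "y \<in> K"
    then have "\<epsilon> y * \<epsilon> (inv y) = 1" using mult[of y "inv y"] by (simp add: K_def one)
    then show "inv y \<in> K" using y by (simp add: K_def)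
  qed (use one in \<open>auto simp: K_def mult\<close>)
  have "bij_betw (\<lambda>z. t \<otimes> z) K (carrier G - K)"
    by (rule bij_betwI[where g = "\<lambda>z. t \<otimes> z"]) (use pm in \<open>auto simp: K_def mult \<epsilon>_t tt dest: pm'\<close>)
  then have "card K = card (carrier G - K)" by (rule bij_betw_same_card)
  also have "\<dots> = card (carrier G) - card K"
    using fin by (intro card_Diff_subset) (auto simp: K_def intro: finite_subset)
  finally have card_K: "card K = n" using n by (simp add: order_def)
  have iff: "\<epsilon> y = 1 \<longleftrightarrow> y [^] n = \<one>" if y: "y \<in> carrier G" for y
  proof
    assume "\<epsilon> y = 1"
    then have "y \<in> K" using y by (simp add: K_def)
    then have "y [^]\<^bsub>G\<lparr>carrier := K\<rparr>\<^esub> order (G\<lparr>carrier := K\<rparr>) = \<one>\<^bsub>G\<lparr>carrier := K\<rparr>\<^esub>"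
      using group.pow_order_eq_1[OF subgroup.subgroup_is_group[OF K is_group]] by simp
    then show "y [^] n = \<one>" by (simp add: order_def card_K nat_pow_consistent[symmetric])
  next
    assume "y [^] n = \<one>"
    then have "\<epsilon> y ^ n = 1" using pow[OF y, of n] one by simp
    then show "\<epsilon> y = 1" using pm[of y] n(2) by auto
  qed
  have "{y \<in> carrier G. y [^] n = \<one>} = K" using iff by (auto simp: K_def)
  then show thesis using that[of t \<epsilon>] tc ord_t \<epsilon>_t mult iff pm card_K by auto
qed

section \<open>Realizability\<close>

text \<open>
  The first component is written \<open>1 mod n\<close> to cover \<open>n = 1\<close>, where the generator of \<open>\<int>\<^sub>n\<close> is 0.
\<close>

lemma semidirect_cyclic_generator:
  fixes n :: nat and \<phi> :: "int \<Rightarrow> int \<Rightarrow> int"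
  assumes n: "n > 0" and \<phi>: "\<phi> \<in> hom B (AutoGroup (integer_mod_group n))" and B: "group B"
  defines "P \<equiv> semidirect_product (integer_mod_group n) \<phi> B"
  shows "(1 mod int n, \<one>\<^bsub>B\<^esub>) \<in> carrier P"
    and "(1 mod int n, \<one>\<^bsub>B\<^esub>) [^]\<^bsub>P\<^esub> (i::nat) = \<one>\<^bsub>P\<^esub> \<longleftrightarrow> n dvd i"
proof -
  interpret B: group B by (rule B)
  have one: "1 mod int n \<in> carrier (integer_mod_group n)"
    using n by (simp add: carrier_integer_mod_group)
  then show "(1 mod int n, \<one>\<^bsub>B\<^esub>) \<in> carrier P" by (simp add: P_def)
  have "\<phi> \<one>\<^bsub>B\<^esub> = \<one>\<^bsub>AutoGroup (integer_mod_group n)\<^esub>"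
    by (rule hom_one[OF \<phi> B group.AutoGroup]) simp
  then have id: "\<phi> \<one>\<^bsub>B\<^esub> a = a" if "a \<in> carrier (integer_mod_group n)" for a
    using that by (simp add: AutoGroup_def BijGroup_def)
  have pow: "(1 mod int n, \<one>\<^bsub>B\<^esub>) [^]\<^bsub>P\<^esub> i = (int i mod int n, \<one>\<^bsub>B\<^esub>)" for i :: nat
    by (induction i) (use one in \<open>simp_all add: P_def id mod_simps algebra_simps\<close>)
  show "(1 mod int n, \<one>\<^bsub>B\<^esub>) [^]\<^bsub>P\<^esub> (i::nat) = \<one>\<^bsub>P\<^esub> \<longleftrightarrow> n dvd i"
    by (simp add: pow) (simp add: P_def mod_eq_0_iff_dvd)
qed

text \<open>
  The point \<open>s i\<close> is the image of 1 under \<open>(x, \<alpha>)\<^sup>i\<close>, so \<open>s k = 1\<close> puts \<open>(x, \<alpha>)\<^sup>k\<close> into the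
  stabilizer of 1, which is trivial.
\<close>

lemma regular_subgroup_element:
  assumes N: "group N" and reg: "regular_subgroup H N" and g: "(x, \<alpha>) \<in> H"
    and ord: "\<And>i::nat. (x, \<alpha>) [^]\<^bsub>holomorph N\<^esub> i = \<one>\<^bsub>holomorph N\<^esub> \<longleftrightarrow> n dvd i"
  defines "s \<equiv> \<lambda>i. ((\<lambda>z. x \<otimes>\<^bsub>N\<^esub> \<alpha> z) ^^ i) \<one>\<^bsub>N\<^esub>"
  shows "x \<in> carrier N" "\<alpha> \<in> hom N N" "inj_on \<alpha> (carrier N)"
    and "s n = \<one>\<^bsub>N\<^esub>" "inj_on s {..<n}"
proof -
  interpret N: group N by (rule N)
  interpret Hol: group "holomorph N" by (rule group_holomorph[OF N])
  have H: "subgroup H (holomorph N)" using reg by (simp add: regular_subgroup_def)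
  have gc: "(x, \<alpha>) \<in> carrier (holomorph N)" by (rule subgroup.mem_carrier[OF H g])
  then have xa: "x \<in> carrier N" "\<alpha> \<in> auto N"
    by (simp_all add: holomorph_def AutoGroup_def)
  then show x: "x \<in> carrier N" and \<alpha>: "\<alpha> \<in> hom N N" and inj: "inj_on \<alpha> (carrier N)"
    by (auto simp: auto_def Bij_def bij_betw_def)
  have \<alpha>c [simp]: "\<alpha> z \<in> carrier N" if "z \<in> carrier N" for z
    using \<alpha> that by (auto simp: hom_def)
  have s_Suc: "s (Suc i) = x \<otimes>\<^bsub>N\<^esub> \<alpha> (s i)" for i by (simp add: s_def)
  have s_closed [simp]: "s i \<in> carrier N" for i by (induction i) (simp_all add: s_def x)
  have powers: "fst ((x, \<alpha>) [^]\<^bsub>holomorph N\<^esub> i) = s i" for i :: nat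
  proof (induction i)
    case 0
    then show ?case by (simp add: holomorph_def s_def)
  next
    case (Suc i)
    obtain y \<beta> where y: "(x, \<alpha>) [^]\<^bsub>holomorph N\<^esub> i = (y, \<beta>)" by fastforce
    have "(x, \<alpha>) [^]\<^bsub>holomorph N\<^esub> Suc i = (x, \<alpha>) \<otimes>\<^bsub>holomorph N\<^esub> (y, \<beta>)"
      using Hol.nat_pow_Suc2[OF gc, of i] y by simp
    then show ?case using Suc y by (simp add: s_Suc) (simp add: holomorph_def)
  qed
  show "s n = \<one>\<^bsub>N\<^esub>" using powers[of n] ord[of n] by (simp add: holomorph_def)
  have dvd: "n dvd k" if sk: "s k = \<one>\<^bsub>N\<^esub>" for k
  proof -
    let ?g = "(x, \<alpha>) [^]\<^bsub>holomorph N\<^esub> k"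
    obtain \<beta> where \<beta>: "?g = (\<one>\<^bsub>N\<^esub>, \<beta>)" using powers[of k] sk by (metis prod.collapse)
    have "?g \<in> H"
      using Hol.subgroup_int_pow_closed[OF H g, of "int k"] by (simp add: int_pow_int)
    then have "(\<one>\<^bsub>N\<^esub>, \<beta>) \<in> carrier (holomorph N)" using \<beta> subgroup.mem_carrier[OF H] by metis
    then have "\<beta> \<in> hom N N" by (auto simp: holomorph_def AutoGroup_def auto_def)
    then have "\<beta> \<one>\<^bsub>N\<^esub> = \<one>\<^bsub>N\<^esub>" by (intro hom_one N)
    then have "?g \<in> stabilizer (holomorph N\<lparr>carrier := H\<rparr>) (holomorph_action N) \<one>\<^bsub>N\<^esub>"
      using \<open>?g \<in> H\<close> \<beta> by (simp add: stabilizer_def holomorph_action_def)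
    then have "?g = \<one>\<^bsub>holomorph N\<^esub>" using reg by (auto simp: regular_subgroup_def)
    then show ?thesis by (simp only: ord)
  qed
  have shift: "s k = \<one>\<^bsub>N\<^esub>" if "s (i + k) = s i" for i k
    using that
  proof (induction i)
    case 0
    then show ?case by (simp add: s_def)
  next
    case (Suc i)
    then have "\<alpha> (s (i + k)) = \<alpha> (s i)" using x by (simp add: s_Suc)
    then show ?case using Suc.IH inj by (simp add: inj_on_eq_iff)
  qed
  show "inj_on s {..<n}"
  proof (rule linorder_inj_onI)
    fix i j assume ij: "i < j" "i \<in> {..<n}" "j \<in> {..<n}"
    show "s i \<noteq> s j"
    proof
      assume "s i = s j"
      then have "s (j - i) = \<one>\<^bsub>N\<^esub>" using shift[of i "j - i"] ij by simp
      then have "n dvd j - i" by (rule dvd)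
      then show False using ij by (auto dest: dvd_imp_le)
    qed
  qed auto
qed

theorem theorem3p2:
  fixes n :: nat and \<phi> :: "int \<Rightarrow> int \<Rightarrow> int" and N :: "('a, 'b) monoid_scheme"
  assumes "n > 0" and "odd n"
    and "\<phi> \<in> hom (integer_mod_group 2) (AutoGroup (integer_mod_group n))"
    and "group N" and "order N = 2 * n"
    and "realizable (semidirect_product (integer_mod_group n) \<phi> (integer_mod_group 2)) N"
  shows "\<exists>(k::nat) (l::nat) \<alpha> \<beta>.
    k > 0 \<and> l > 0 \<and> gcd k l = 1 \<and> k * l = n \<and>
    \<alpha> \<in> hom (integer_mod_group l) (AutoGroup (integer_mod_group k)) \<and>
    \<beta> \<in> hom (integer_mod_group 2)
           (AutoGroup (semidirect_product (integer_mod_group k) \<alpha> (integer_mod_group l))) \<and>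
    N \<cong> semidirect_product
           (semidirect_product (integer_mod_group k) \<alpha> (integer_mod_group l))
           \<beta> (integer_mod_group 2)"
proof -
  interpret N: group N by fact
  let ?P = "semidirect_product (integer_mod_group n) \<phi> (integer_mod_group 2)"
  have fin: "finite (carrier N)" using assms(6) by (simp add: realizable_def)
  obtain H where reg: "regular_subgroup H N" and iso: "(holomorph N\<lparr>carrier := H\<rparr>) \<cong> ?P"
    using assms(6) by (auto simp: realizable_def)
  obtain t and \<epsilon> :: "'a \<Rightarrow> int" where t: "t \<in> carrier N" "N.ord t = 2" "\<epsilon> t = -1"
    and \<epsilon>_mult: "\<And>y z. y \<in> carrier N \<Longrightarrow> z \<in> carrier N \<Longrightarrow> \<epsilon> (y \<otimes>\<^bsub>N\<^esub> z) = \<epsilon> y * \<epsilon> z"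
    and \<epsilon>_iff: "\<And>y. y \<in> carrier N \<Longrightarrow> \<epsilon> y = 1 \<longleftrightarrow> y [^]\<^bsub>N\<^esub> n = \<one>\<^bsub>N\<^esub>"
    and \<epsilon>_pm: "\<And>y. y \<in> carrier N \<Longrightarrow> \<epsilon> y = 1 \<or> \<epsilon> y = -1"
    and card_K: "card {y \<in> carrier N. y [^]\<^bsub>N\<^esub> n = \<one>\<^bsub>N\<^esub>} = n"
    by (rule N.regular_sign_character[OF fin assms(5,2)]) (rule that; assumption)
  define K where "K = {y \<in> carrier N. y [^]\<^bsub>N\<^esub> n = \<one>\<^bsub>N\<^esub>}"
  have cK: "card K = n" using card_K by (simp only: K_def)
  have mem_K: "y \<in> K \<longleftrightarrow> y \<in> carrier N \<and> \<epsilon> y = 1" for y using \<epsilon>_iff by (auto simp: K_def)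
  have K: "K \<lhd> N"
  proof (rule N.normal_invI)
    have \<epsilon>_one: "\<epsilon> \<one>\<^bsub>N\<^esub> = 1" by (simp add: \<epsilon>_iff)
    show "subgroup K N"
    proof (rule N.subgroupI)
      fix y assume y: "y \<in> K"
      then have "\<epsilon> y * \<epsilon> (inv\<^bsub>N\<^esub> y) = 1"
        using \<epsilon>_mult[of y "inv\<^bsub>N\<^esub> y"] \<epsilon>_one by (simp add: mem_K)
      then show "inv\<^bsub>N\<^esub> y \<in> K" using y by (simp add: mem_K)
    next
      have "\<one>\<^bsub>N\<^esub> \<in> K" using \<epsilon>_one by (simp add: mem_K)
      then show "K \<noteq> {}" by blast
    qed (auto simp: mem_K \<epsilon>_mult)
    fix g h assume g: "g \<in> carrier N" "h \<in> K"
    have "\<epsilon> g * \<epsilon> (inv\<^bsub>N\<^esub> g) = 1" using \<epsilon>_mult[of g "inv\<^bsub>N\<^esub> g"] \<epsilon>_one g by simp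
    then show "g \<otimes>\<^bsub>N\<^esub> h \<otimes>\<^bsub>N\<^esub> inv\<^bsub>N\<^esub> g \<in> K" using g by (simp add: mem_K \<epsilon>_mult)
  qed
  interpret K: normal K N by (rule K)

  \<comment> \<open>The generator of \<open>\<int>\<^sub>n\<close>, transported to the regular subgroup.\<close>
  obtain x \<alpha> where x: "x \<in> carrier N" and \<alpha>: "\<alpha> \<in> hom N N" "inj_on \<alpha> (carrier N)"
    and s: "((\<lambda>z. x \<otimes>\<^bsub>N\<^esub> \<alpha> z) ^^ n) \<one>\<^bsub>N\<^esub> = \<one>\<^bsub>N\<^esub>"
      "inj_on (\<lambda>i. ((\<lambda>z. x \<otimes>\<^bsub>N\<^esub> \<alpha> z) ^^ i) \<one>\<^bsub>N\<^esub>) {..<n}"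
  proof -
    let ?H = "holomorph N\<lparr>carrier := H\<rparr>" and ?u = "(1 mod int n, \<one>\<^bsub>integer_mod_group 2\<^esub>)"
    have sub: "subgroup H (holomorph N)" using reg by (simp add: regular_subgroup_def)
    have gH: "group ?H" by (rule subgroup.subgroup_is_group[OF sub group_holomorph[OF assms(4)]])
    have gP: "group ?P" by (rule group_semidirect_product) (use assms(3) in auto)
    obtain \<psi> where \<psi>: "\<psi> \<in> iso ?P ?H"
      using group.iso_sym[OF gH iso] by (auto simp: is_iso_def)
    interpret \<psi>: group_hom ?P ?H \<psi>
      by (intro group_hom.intro group_hom_axioms.intro gP gH) (use \<psi> in \<open>simp add: iso_def\<close>)
    note u = semidirect_cyclic_generator[OF assms(1,3) group_integer_mod_group]
    have inj: "inj_on \<psi> (carrier ?P)" using \<psi> by (simp only: iso_iff)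
    have \<psi>_one: "\<psi> \<one>\<^bsub>?P\<^esub> = \<one>\<^bsub>holomorph N\<^esub>" by (rule trans[OF \<psi>.hom_one]) simp
    obtain x \<alpha> where g: "\<psi> ?u = (x, \<alpha>)" by fastforce
    have "(x, \<alpha>) [^]\<^bsub>holomorph N\<^esub> i = \<one>\<^bsub>holomorph N\<^esub> \<longleftrightarrow> n dvd i" for i :: nat
    proof -
      have "(x, \<alpha>) [^]\<^bsub>holomorph N\<^esub> i = \<psi> (?u [^]\<^bsub>?P\<^esub> i)"
        using \<psi>.hom_nat_pow[OF u(1), of i] g
        by (simp add: monoid.nat_pow_consistent[OF group.is_monoid[OF group_holomorph[OF assms(4)]]])
      also have "\<dots> = \<one>\<^bsub>holomorph N\<^esub> \<longleftrightarrow> ?u [^]\<^bsub>?P\<^esub> i = \<one>\<^bsub>?P\<^esub>"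
        unfolding \<psi>_one[symmetric]
        by (rule inj_on_eq_iff[OF inj \<psi>.G.nat_pow_closed[OF u(1)] \<psi>.G.one_closed])
      finally show ?thesis using u(2) by simp
    qed
    moreover have "(x, \<alpha>) \<in> H" using \<psi>.hom_closed[OF u(1)] g by simp
    ultimately show thesis
      using regular_subgroup_element[OF assms(4) reg] that by blast
  qed
  define s' where "s' i = ((\<lambda>z. x \<otimes>\<^bsub>N\<^esub> \<alpha> z) ^^ i) \<one>\<^bsub>N\<^esub>" for i
  interpret \<alpha>: group_hom N N \<alpha> by (intro group_hom.intro group_hom_axioms.intro \<alpha> assms(4))
  have \<alpha>_\<epsilon>: "\<epsilon> (\<alpha> y) = \<epsilon> y" if "y \<in> carrier N" for y
  proof -
    have "\<alpha> y [^]\<^bsub>N\<^esub> n = \<one>\<^bsub>N\<^esub> \<longleftrightarrow> y [^]\<^bsub>N\<^esub> n = \<one>\<^bsub>N\<^esub>"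
      using inj_on_eq_iff[OF \<alpha>(2) N.nat_pow_closed[OF that, of n] N.one_closed]
        \<alpha>.hom_nat_pow[OF that, of n] \<alpha>.hom_one by simp
    then have "\<epsilon> (\<alpha> y) = 1 \<longleftrightarrow> \<epsilon> y = 1" using that by (simp add: \<epsilon>_iff)
    then show ?thesis using \<epsilon>_pm[of y] \<epsilon>_pm[of "\<alpha> y"] that by auto
  qed
  have s': "s' i \<in> carrier N \<and> \<epsilon> (s' i) = \<epsilon> x ^ i" for i
    by (induction i) (use x in \<open>simp_all add: s'_def \<epsilon>_mult \<alpha>_\<epsilon> \<epsilon>_iff\<close>)
  \<comment> \<open>The walk returns to 1 after \<open>n\<close> steps, and each step multiplies \<open>\<epsilon>\<close> by \<open>\<epsilon> x\<close>; as \<open>n\<close> is odd, the walk stays in \<open>K\<close>.\<close>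
  have "\<epsilon> x ^ n = 1" using s'[of n] s(1) \<epsilon>_iff[of "\<one>\<^bsub>N\<^esub>"] by (simp add: s'_def)
  then have \<epsilon>x: "\<epsilon> x = 1" using \<epsilon>_pm[OF x] assms(2) by auto
  have "s' ` {..<n} = K"
  proof (rule card_subset_eq)
    show "finite K" by (rule finite_subset[OF K.subset fin])
    have "s' i \<in> K" for i unfolding mem_K using s'[of i] by (simp only: \<epsilon>x power_one simp_thms)
    then show "s' ` {..<n} \<subseteq> K" by blast
    show "card (s' ` {..<n}) = card K"
      using card_image[OF s(2)] cK by (simp add: s'_def)
  qed
  then have reach: "\<exists>i. y = s' i" if "y \<in> K" for y using that by blast
  let ?K = "N\<lparr>carrier := K\<rparr>"
  interpret KG: group ?K by (rule subgroup.subgroup_is_group[OF K.subgroup_axioms assms(4)])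
  interpret C: cyclic_transitive ?K x \<alpha>
  proof (intro cyclic_transitive.intro cyclic_transitive_axioms.intro KG.is_group)
    show "\<alpha> \<in> hom ?K ?K" by (rule homI) (simp_all add: mem_K \<alpha>_\<epsilon> del: K.mem_carrier)
    show "\<exists>i. y = ((\<lambda>z. x \<otimes>\<^bsub>?K\<^esub> \<alpha> z) ^^ i) \<one>\<^bsub>?K\<^esub>" if "y \<in> carrier ?K" for y
      using reach[of y] that by (simp add: s'_def)
  qed (use finite_subset[OF K.subset fin] x \<epsilon>x inj_on_subset[OF \<alpha>(2) K.subset] in \<open>simp_all add: mem_K del: K.mem_carrier\<close>)
  have oK: "order ?K = n" using cK by (simp add: order_def)
  obtain a b where ab: "a \<in> carrier ?K" "b \<in> carrier ?K" "generate ?K {a} \<lhd> ?K"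
    "generate ?K {a} \<inter> generate ?K {b} = {\<one>\<^bsub>?K\<^esub>}" "KG.ord a * KG.ord b = order ?K"
    "coprime (KG.ord a) (KG.ord b)"
    using C.coprime_metacyclic assms(2) oK by metis
  define k where "k = KG.ord a"
  define l where "l = KG.ord b"
  have kl: "k * l = n" "coprime k l" using ab oK by (simp_all add: k_def l_def)
  then have pos: "k > 0" "l > 0" using assms(1) by auto
  \<comment> \<open>First \<open>K = \<int>\<^sub>k \<rtimes> \<int>\<^sub>l\<close>, then \<open>N = K \<rtimes> \<langle>t\<rangle>\<close>.\<close>
  note ea = KG.integer_mod_group_embedding[OF ab(1) k_def[symmetric] pos(1)]
  note eb = KG.integer_mod_group_embedding[OF ab(2) l_def[symmetric] pos(2)]
  obtain \<gamma> where \<gamma>: "\<gamma> \<in> hom (integer_mod_group l) (AutoGroup (integer_mod_group k))"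
    "?K \<cong> semidirect_product (integer_mod_group k) \<gamma> (integer_mod_group l)"
  proof (rule internal_semidirect_product[OF KG.is_group group_integer_mod_group group_integer_mod_group
        C.finite_carrier ea(1,2) eb(1,2)])
    show "([^]\<^bsub>?K\<^esub>) a ` carrier (integer_mod_group k) \<lhd> ?K" unfolding ea(3) by (rule ab(3))
    show "([^]\<^bsub>?K\<^esub>) a ` carrier (integer_mod_group k) \<inter> ([^]\<^bsub>?K\<^esub>) b ` carrier (integer_mod_group l)
        \<subseteq> {\<one>\<^bsub>?K\<^esub>}" unfolding ea(3) eb(3) ab(4) ..
    show "order (integer_mod_group k) * order (integer_mod_group l) = order ?K"
      using pos kl oK by (simp add: order_integer_mod_group)
  qed
  let ?S = "semidirect_product (integer_mod_group k) \<gamma> (integer_mod_group l)"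
  have gS: "group ?S" by (rule group_semidirect_product) (use \<gamma>(1) in auto)
  obtain h where h: "h \<in> iso ?S ?K"
    using KG.iso_sym[OF \<gamma>(2)] by (auto simp: is_iso_def)
  have h': "h \<in> hom ?S N" "inj_on h (carrier ?S)" "h ` carrier ?S = K"
    using h by (auto simp: iso_iff hom_def simp del: carrier_semidirect_product)
  note et = N.integer_mod_group_embedding[OF t(1,2), simplified]
  obtain \<beta> where "\<beta> \<in> hom (integer_mod_group 2) (AutoGroup ?S)"
    "N \<cong> semidirect_product ?S \<beta> (integer_mod_group 2)"
  proof (rule internal_semidirect_product[OF assms(4) gS group_integer_mod_group fin h'(1,2) et(1,2)])
    show "h ` carrier ?S \<lhd> N" unfolding h'(3) by (rule K)
    have "carrier (integer_mod_group 2) = {0, 1}" by (auto simp: carrier_integer_mod_group)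
    then show "h ` carrier ?S \<inter> ([^]\<^bsub>N\<^esub>) t ` carrier (integer_mod_group 2) \<subseteq> {\<one>\<^bsub>N\<^esub>}"
      unfolding h'(3) using t by (auto simp: mem_K simp del: K.mem_carrier)
    have "order ?S = n" using pos kl
      by (simp add: order_def card_cartesian_product carrier_integer_mod_group)
    then show "order ?S * order (integer_mod_group 2) = order N"
      using assms(5) by (simp add: order_integer_mod_group)
  qed
  with \<gamma>(1) kl pos show ?thesis
    by (intro exI[of _ k] exI[of _ l] exI[of _ \<gamma>] exI[of _ \<beta>]) (simp add: coprime_iff_gcd_eq_1)
qed

end
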